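(* Let $\mathcal F$ be a set of finitely generated profinite semigroups. When equipped with the pointwise topology, the category $\mathbf{Pro}[\mathcal F]$ is a topological category. If moreover $\mathcal F$ is finite, then $\mathbf{Pro}[\mathcal F]$ is a profinite category.
   Context: A profinite semigroup is an inverse limit of finite discrete semigroups; it is finitely generated if some finite subset generates a dense subsemigroup. $\mathbf{Pro}$ is the category of profinite semigroups with continuous semigroup homomorphisms, and $\mathbf{Pro}[\mathcal F]$ is its full subcategory with object set $\mathcal F$. A topological category is a small category with topologies on its set of objects and its set of morphisms such that the domain and codomain maps, the composition map (on the subspace of composable pairs), and the map $q\mapsto 1_q$ sending an object to its identity are continuous. A profinite category is an inverse limit of finite (discrete) categories, as topological categories. That $\mathbf{Pro}[\mathcal F]$ is equipped with the pointwise topology means: $\mathcal F$ has the discrete topology; each set $\mathrm{Hom}(S,R)$ of continuous homomorphisms ($S,R\in\mathcal F$) has the topology of pointwise convergence; and the set of all morphisms has the coproduct (disjoint union) topology of the spaces $\mathrm{Hom}(S,R)$. *)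

theory Defs
  imports "HOL-Analysis.Analysis"
begin

section \<open>Topological semigroups\<close>

record 'a top_semigroup =
  sg_top :: "'a topology"
  sg_mult :: "'a \<Rightarrow> 'a \<Rightarrow> 'a"

abbreviation sg_carrier :: "'a top_semigroup \<Rightarrow> 'a set"
  where "sg_carrier S \<equiv> topspace (sg_top S)"

definition topological_semigroup :: "'a top_semigroup \<Rightarrow> bool" where
  "topological_semigroup S \<longleftrightarrow>
     (\<forall>x\<in>sg_carrier S. \<forall>y\<in>sg_carrier S. sg_mult S x y \<in> sg_carrier S) \<and>
     (\<forall>x\<in>sg_carrier S. \<forall>y\<in>sg_carrier S. \<forall>z\<in>sg_carrier S.
        sg_mult S (sg_mult S x y) z = sg_mult S x (sg_mult S y z)) \<and>
     continuous_map (prod_topology (sg_top S) (sg_top S)) (sg_top S) (\<lambda>(x, y). sg_mult S x y)"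

definition continuous_sg_hom ::
  "'a top_semigroup \<Rightarrow> 'b top_semigroup \<Rightarrow> ('a \<Rightarrow> 'b) \<Rightarrow> bool" where
  "continuous_sg_hom S R f \<longleftrightarrow>
     continuous_map (sg_top S) (sg_top R) f \<and>
     (\<forall>x\<in>sg_carrier S. \<forall>y\<in>sg_carrier S. f (sg_mult S x y) = sg_mult R (f x) (f y))"

definition top_sg_iso ::
  "'a top_semigroup \<Rightarrow> 'b top_semigroup \<Rightarrow> ('a \<Rightarrow> 'b) \<Rightarrow> bool" where
  "top_sg_iso S R f \<longleftrightarrow> continuous_sg_hom S R f \<and> homeomorphic_map (sg_top S) (sg_top R) f"

definition finite_discrete :: "'a topology \<Rightarrow> bool" where
  "finite_discrete T \<longleftrightarrow> finite (topspace T) \<and> T = discrete_topology (topspace T)"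

definition subsemigroup :: "'a top_semigroup \<Rightarrow> 'a set \<Rightarrow> bool" where
  "subsemigroup S B \<longleftrightarrow>
     B \<subseteq> sg_carrier S \<and> (\<forall>x\<in>B. \<forall>y\<in>B. sg_mult S x y \<in> B)"

text \<open>Here \<open>subsemigroup S hull A\<close> is the subsemigroup of \<open>S\<close> generated by \<open>A\<close>.\<close>

definition finitely_generated :: "'a top_semigroup \<Rightarrow> bool" where
  "finitely_generated S \<longleftrightarrow>
     (\<exists>A. finite A \<and> A \<subseteq> sg_carrier S \<and>
          sg_top S closure_of (subsemigroup S hull A) = sg_carrier S)"


section \<open>Inverse limits\<close>

text \<open>A pair \<open>(i, j) \<in> r\<close> means \<open>i \<le> j\<close>; the bonding map \<open>\<phi> i j\<close> then goes from the
  \<open>j\<close>-th to the \<open>i\<close>-th object of the system.\<close>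

definition directed_set :: "'i set \<Rightarrow> ('i \<times> 'i) set \<Rightarrow> bool" where
  "directed_set I r \<longleftrightarrow>
     I \<noteq> {} \<and> preorder_on I r \<and> (\<forall>i\<in>I. \<forall>j\<in>I. \<exists>k\<in>I. (i, k) \<in> r \<and> (j, k) \<in> r)"

definition functorial_system ::
  "'i set \<Rightarrow> ('i \<times> 'i) set \<Rightarrow> ('i \<Rightarrow> 'b topology) \<Rightarrow> ('i \<Rightarrow> 'i \<Rightarrow> 'b \<Rightarrow> 'b) \<Rightarrow> bool" where
  "functorial_system I r T \<phi> \<longleftrightarrow>
     (\<forall>i\<in>I. \<forall>x\<in>topspace (T i). \<phi> i i x = x) \<and>
     (\<forall>i j k. (i, j) \<in> r \<longrightarrow> (j, k) \<in> r \<longrightarrow>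
        (\<forall>x\<in>topspace (T k). \<phi> i j (\<phi> j k x) = \<phi> i k x))"

definition limit_topology ::
  "'i set \<Rightarrow> ('i \<times> 'i) set \<Rightarrow> ('i \<Rightarrow> 'b topology) \<Rightarrow> ('i \<Rightarrow> 'i \<Rightarrow> 'b \<Rightarrow> 'b) \<Rightarrow> ('i \<Rightarrow> 'b) topology"
  where
  "limit_topology I r T \<phi> =
     subtopology (product_topology T I) {x. \<forall>(i, j)\<in>r. \<phi> i j (x j) = x i}"


section \<open>Profinite semigroups\<close>

definition sg_inverse_system ::
  "'i set \<Rightarrow> ('i \<times> 'i) set \<Rightarrow> ('i \<Rightarrow> 'b top_semigroup) \<Rightarrow> ('i \<Rightarrow> 'i \<Rightarrow> 'b \<Rightarrow> 'b) \<Rightarrow> bool" where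
  "sg_inverse_system I r X \<phi> \<longleftrightarrow>
     directed_set I r \<and>
     (\<forall>i\<in>I. topological_semigroup (X i)) \<and>
     (\<forall>(i, j)\<in>r. continuous_sg_hom (X j) (X i) (\<phi> i j)) \<and>
     functorial_system I r (\<lambda>i. sg_top (X i)) \<phi>"

definition sg_inverse_limit ::
  "'i set \<Rightarrow> ('i \<times> 'i) set \<Rightarrow> ('i \<Rightarrow> 'b top_semigroup) \<Rightarrow> ('i \<Rightarrow> 'i \<Rightarrow> 'b \<Rightarrow> 'b) \<Rightarrow>
     ('i \<Rightarrow> 'b) top_semigroup" where
  "sg_inverse_limit I r X \<phi> =
     \<lparr> sg_top = limit_topology I r (\<lambda>i. sg_top (X i)) \<phi>,
       sg_mult = (\<lambda>x y. \<lambda>i\<in>I. sg_mult (X i) (x i) (y i)) \<rparr>"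

text \<open>The types of the index set and of the finite semigroups have to be fixed in advance. This is
  no restriction. A finite semigroup is isomorphic to one carried by natural numbers. If \<open>S\<close> is the
  inverse limit of finite semigroups along projections \<open>\<pi> i\<close>, then it is also the inverse limit of
  the images of the \<open>\<pi> i\<close>, which may be indexed by the kernel congruences of the \<open>\<pi> i\<close>, ordered by
  reverse inclusion.\<close>

definition profinite_semigroup :: "'a top_semigroup \<Rightarrow> bool" where
  "profinite_semigroup S \<longleftrightarrow>
     topological_semigroup S \<and>
     (\<exists>(I :: ('a \<times> 'a) set set) r (X :: ('a \<times> 'a) set \<Rightarrow> nat top_semigroup) \<phi> h.
        sg_inverse_system I r X \<phi> \<and>
        (\<forall>i\<in>I. finite_discrete (sg_top (X i))) \<and>
        top_sg_iso S (sg_inverse_limit I r X \<phi>) h)"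


section \<open>Topological categories\<close>

text \<open>\<open>cat_comp C g f\<close> is \<open>g\<close> after \<open>f\<close>.\<close>

record ('o, 'm) top_category =
  ob_top :: "'o topology"
  mor_top :: "'m topology"
  cat_dom :: "'m \<Rightarrow> 'o"
  cat_cod :: "'m \<Rightarrow> 'o"
  cat_comp :: "'m \<Rightarrow> 'm \<Rightarrow> 'm"
  cat_id :: "'o \<Rightarrow> 'm"

abbreviation cat_ob :: "('o, 'm) top_category \<Rightarrow> 'o set"
  where "cat_ob C \<equiv> topspace (ob_top C)"

abbreviation cat_mor :: "('o, 'm) top_category \<Rightarrow> 'm set"
  where "cat_mor C \<equiv> topspace (mor_top C)"

definition composable_pairs :: "('o, 'm) top_category \<Rightarrow> ('m \<times> 'm) set" where
  "composable_pairs C =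
     {(g, f). g \<in> cat_mor C \<and> f \<in> cat_mor C \<and> cat_dom C g = cat_cod C f}"

definition is_category :: "('o, 'm) top_category \<Rightarrow> bool" where
  "is_category C \<longleftrightarrow>
     (\<forall>f\<in>cat_mor C. cat_dom C f \<in> cat_ob C \<and> cat_cod C f \<in> cat_ob C) \<and>
     (\<forall>q\<in>cat_ob C. cat_id C q \<in> cat_mor C \<and>
        cat_dom C (cat_id C q) = q \<and> cat_cod C (cat_id C q) = q) \<and>
     (\<forall>(g, f)\<in>composable_pairs C. cat_comp C g f \<in> cat_mor C \<and>
        cat_dom C (cat_comp C g f) = cat_dom C f \<and>
        cat_cod C (cat_comp C g f) = cat_cod C g) \<and>
     (\<forall>f\<in>cat_mor C. cat_comp C f (cat_id C (cat_dom C f)) = f \<and>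
        cat_comp C (cat_id C (cat_cod C f)) f = f) \<and>
     (\<forall>h g f. (h, g) \<in> composable_pairs C \<longrightarrow> (g, f) \<in> composable_pairs C \<longrightarrow>
        cat_comp C (cat_comp C h g) f = cat_comp C h (cat_comp C g f))"

definition topological_category :: "('o, 'm) top_category \<Rightarrow> bool" where
  "topological_category C \<longleftrightarrow>
     is_category C \<and>
     continuous_map (mor_top C) (ob_top C) (cat_dom C) \<and>
     continuous_map (mor_top C) (ob_top C) (cat_cod C) \<and>
     continuous_map (subtopology (prod_topology (mor_top C) (mor_top C)) (composable_pairs C))
       (mor_top C) (\<lambda>(g, f). cat_comp C g f) \<and>
     continuous_map (ob_top C) (mor_top C) (cat_id C)"

definition continuous_functor ::
  "('o, 'm) top_category \<Rightarrow> ('p, 'n) top_category \<Rightarrow> ('o \<Rightarrow> 'p) \<Rightarrow> ('m \<Rightarrow> 'n) \<Rightarrow> bool" where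
  "continuous_functor C D \<alpha> \<beta> \<longleftrightarrow>
     continuous_map (ob_top C) (ob_top D) \<alpha> \<and>
     continuous_map (mor_top C) (mor_top D) \<beta> \<and>
     (\<forall>f\<in>cat_mor C. cat_dom D (\<beta> f) = \<alpha> (cat_dom C f) \<and> cat_cod D (\<beta> f) = \<alpha> (cat_cod C f)) \<and>
     (\<forall>q\<in>cat_ob C. \<beta> (cat_id C q) = cat_id D (\<alpha> q)) \<and>
     (\<forall>(g, f)\<in>composable_pairs C. \<beta> (cat_comp C g f) = cat_comp D (\<beta> g) (\<beta> f))"

definition top_category_iso ::
  "('o, 'm) top_category \<Rightarrow> ('p, 'n) top_category \<Rightarrow> ('o \<Rightarrow> 'p) \<Rightarrow> ('m \<Rightarrow> 'n) \<Rightarrow> bool" where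
  "top_category_iso C D \<alpha> \<beta> \<longleftrightarrow>
     continuous_functor C D \<alpha> \<beta> \<and>
     homeomorphic_map (ob_top C) (ob_top D) \<alpha> \<and>
     homeomorphic_map (mor_top C) (mor_top D) \<beta>"

definition cat_inverse_system ::
  "'i set \<Rightarrow> ('i \<times> 'i) set \<Rightarrow> ('i \<Rightarrow> ('o, 'm) top_category) \<Rightarrow>
     ('i \<Rightarrow> 'i \<Rightarrow> 'o \<Rightarrow> 'o) \<Rightarrow> ('i \<Rightarrow> 'i \<Rightarrow> 'm \<Rightarrow> 'm) \<Rightarrow> bool" where
  "cat_inverse_system I r X \<phi> \<psi> \<longleftrightarrow>
     directed_set I r \<and>
     (\<forall>i\<in>I. topological_category (X i)) \<and>
     (\<forall>(i, j)\<in>r. continuous_functor (X j) (X i) (\<phi> i j) (\<psi> i j)) \<and>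
     functorial_system I r (\<lambda>i. ob_top (X i)) \<phi> \<and>
     functorial_system I r (\<lambda>i. mor_top (X i)) \<psi>"

definition cat_inverse_limit ::
  "'i set \<Rightarrow> ('i \<times> 'i) set \<Rightarrow> ('i \<Rightarrow> ('o, 'm) top_category) \<Rightarrow>
     ('i \<Rightarrow> 'i \<Rightarrow> 'o \<Rightarrow> 'o) \<Rightarrow> ('i \<Rightarrow> 'i \<Rightarrow> 'm \<Rightarrow> 'm) \<Rightarrow> ('i \<Rightarrow> 'o, 'i \<Rightarrow> 'm) top_category" where
  "cat_inverse_limit I r X \<phi> \<psi> =
     \<lparr> ob_top = limit_topology I r (\<lambda>i. ob_top (X i)) \<phi>,
       mor_top = limit_topology I r (\<lambda>i. mor_top (X i)) \<psi>,
       cat_dom = (\<lambda>f. \<lambda>i\<in>I. cat_dom (X i) (f i)),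
       cat_cod = (\<lambda>f. \<lambda>i\<in>I. cat_cod (X i) (f i)),
       cat_comp = (\<lambda>g f. \<lambda>i\<in>I. cat_comp (X i) (g i) (f i)),
       cat_id = (\<lambda>q. \<lambda>i\<in>I. cat_id (X i) (q i)) \<rparr>"

text \<open>Again the choice of types is no restriction. Given an inverse limit \<open>C\<close> of finite categories,
  one may replace them by the subcategories generated by the images of the projections. The system
  may then be indexed by the isomorphism classes of these projections. If \<open>C\<close> has infinitely many
  morphisms, there are at most as many such classes as there are sets of pairs of morphisms of \<open>C\<close>;
  otherwise \<open>C\<close> itself is finite and discrete.\<close>

definition profinite_category :: "('o, 'm) top_category \<Rightarrow> bool" where
  "profinite_category C \<longleftrightarrow>
     topological_category C \<and>
     (\<exists>(I :: ('m \<times> 'm) set set) r (X :: ('m \<times> 'm) set \<Rightarrow> (nat, nat) top_category) \<phi> \<psi> \<alpha> \<beta>.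
        cat_inverse_system I r X \<phi> \<psi> \<and>
        (\<forall>i\<in>I. finite_discrete (ob_top (X i)) \<and> finite_discrete (mor_top (X i))) \<and>
        top_category_iso C (cat_inverse_limit I r X \<phi> \<psi>) \<alpha> \<beta>)"


section \<open>The category of profinite semigroups on a set of objects\<close>

text \<open>Homomorphisms are extensional, so that they are determined by their values on the carrier.\<close>

definition sg_Hom :: "'a top_semigroup \<Rightarrow> 'b top_semigroup \<Rightarrow> ('a \<Rightarrow> 'b) set" where
  "sg_Hom S R = {f \<in> extensional (sg_carrier S). continuous_sg_hom S R f}"

definition pointwise_topology ::
  "'a top_semigroup \<Rightarrow> 'b top_semigroup \<Rightarrow> ('a \<Rightarrow> 'b) topology" where
  "pointwise_topology S R =
     subtopology (product_topology (\<lambda>_. sg_top R) (sg_carrier S)) (sg_Hom S R)"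

text \<open>A morphism from \<open>S\<close> to \<open>R\<close> is a triple \<open>((S, R), f)\<close> with \<open>f \<in> sg_Hom S R\<close>.\<close>

definition Pro_category ::
  "'a top_semigroup set \<Rightarrow>
     ('a top_semigroup, ('a top_semigroup \<times> 'a top_semigroup) \<times> ('a \<Rightarrow> 'a)) top_category" where
  "Pro_category F =
     \<lparr> ob_top = discrete_topology F,
       mor_top = sum_topology (\<lambda>(S, R). pointwise_topology S R) (F \<times> F),
       cat_dom = (\<lambda>((S, R), f). S),
       cat_cod = (\<lambda>((S, R), f). R),
       cat_comp = (\<lambda>((S', R'), g) ((S, R), f). ((S, R'), compose (sg_carrier S) g f)),
       cat_id = (\<lambda>S. ((S, S), \<lambda>x\<in>sg_carrier S. x)) \<rparr>"

end

theory Submission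
  imports Defs
begin

text \<open>Fix \<open>n\<close>. A finitely generated topological semigroup \<open>S\<close> has only finitely many continuous quotient
  maps onto semigroups with elements below \<open>n\<close>, since such a map is determined by a
  multiplication table and the images of the generators. Calling two points of \<open>S\<close> equivalent if no
  such map separates them gives an open equivalence relation, and \<^emph>\<open>every\<close> continuous homomorphism
  respects these relations. This equicontinuity makes composition jointly continuous for
  the pointwise topology, and makes \<open>Hom(S, R)\<close> closed in the compact space \<open>R\<^sup>S\<close>. If \<open>\<F>\<close>
  is finite, the space of morphisms is therefore compact, and the
  relations \<open>f x \<sim>\<^sub>n g x\<close> for all \<open>x\<close> are open congruences of the category that
  separate its morphisms.\<close>

section \<open>Topological preliminaries\<close>

text \<open>Call an element of \<open>finite_quotients n S\<close> a test of size \<open>n\<close>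
  on \<open>S\<close>. Under pointwise convergence composition is in general only separately
  continuous: in \<open>c (g' (f' x))\<close> the point at which \<open>g'\<close> is evaluated
  moves with \<open>f'\<close>, so a control valid for all \<open>g'\<close> at once is required. It
  exists because a test on \<open>R\<close> composed with a homomorphism from \<open>S\<close> to
  \<open>R\<close> is a test on \<open>S\<close> of the same size. For this reason tests carry a
  bound on their values instead of a fixed target, and need not be onto. Finite generation makes the
  tests of a given size finite in number, so that agreement under all of them is an open condition;
  profiniteness makes the tests of all sizes determine the topology. In the quotients of the
  category no objects are identified, so that composites in a quotient are represented by composites
  of the original category.\<close>

lemma continuous_map_discrete_topologyI:
  assumes "\<And>y. y \<in> topspace Y \<Longrightarrow> f y \<in> V"
    and "\<And>y. y \<in> topspace Y \<Longrightarrow> \<exists>U. openin Y U \<and> y \<in> U \<and> (\<forall>z\<in>U. f z = f y)"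
  shows "continuous_map Y (discrete_topology V) f"
  unfolding continuous_map_def
proof (intro conjI allI impI)
  show "f \<in> topspace Y \<rightarrow> topspace (discrete_topology V)"
    using assms(1) by auto
  fix W assume "openin (discrete_topology V) W"
  show "openin Y {x \<in> topspace Y. f x \<in> W}"
  proof (subst openin_subopen, safe)
    fix y assume y: "y \<in> topspace Y" "f y \<in> W"
    then obtain U where "openin Y U" "y \<in> U" "\<forall>z\<in>U. f z \<in> W"
      using assms(2) by metis
    moreover from this have "U \<subseteq> topspace Y"
      by (simp add: openin_subset)
    ultimately show "\<exists>U. openin Y U \<and> y \<in> U \<and> U \<subseteq> {x \<in> topspace Y. f x \<in> W}"
      using y by (intro exI[of _ U]) auto
  qed
qed

lemma openin_discrete_fibre:
  assumes "continuous_map Y (discrete_topology V) f"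
  shows "openin Y {y \<in> topspace Y. f y = v}"
proof -
  have "openin Y {y \<in> topspace Y. f y \<in> V \<inter> {v}}"
    by (rule openin_continuous_map_preimage[OF assms]) simp
  moreover have "{y \<in> topspace Y. f y \<in> V \<inter> {v}} = {y \<in> topspace Y. f y = v}"
    using continuous_map_funspace[OF assms] by auto
  ultimately show ?thesis by simp
qed

lemma compact_space_sum_topology:
  assumes "finite I" "\<And>i. i \<in> I \<Longrightarrow> compact_space (X i)"
  shows "compact_space (sum_topology X I)"
proof -
  have "compactin (sum_topology X I) (\<Union>i\<in>I. Pair i ` topspace (X i))"
    using assms
    by (intro compactin_Union)
      (auto simp: compact_space_def intro!: image_compactin continuous_map_component_injection)
  moreover have "(\<Union>i\<in>I. Pair i ` topspace (X i)) = topspace (sum_topology X I)"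
    by auto
  ultimately show ?thesis
    by (simp add: compact_space_def)
qed

lemma finite_discrete_imp_Hausdorff: "finite_discrete T \<Longrightarrow> Hausdorff_space T"
  unfolding finite_discrete_def by (metis Hausdorff_space_discrete_topology)

lemma finite_discrete_imp_compact: "finite_discrete T \<Longrightarrow> compact_space T"
  unfolding finite_discrete_def by (metis compact_space_discrete_topology)

lemma Hausdorff_limit_topology:
  assumes "\<And>i. i \<in> I \<Longrightarrow> finite_discrete (T i)"
  shows "Hausdorff_space (limit_topology I r T \<phi>)"
  unfolding limit_topology_def
  using assms
  by (intro Hausdorff_space_subtopology)
    (auto simp: Hausdorff_space_product_topology finite_discrete_imp_Hausdorff)

text \<open>Each bonding equation cuts out the equalizer of two continuous maps into a Hausdorff
  space, so the limit is closed in a compact product.\<close>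

lemma compact_limit_topology:
  assumes T: "\<And>i. i \<in> I \<Longrightarrow> finite_discrete (T i)"
    and r: "\<And>i j. (i, j) \<in> r \<Longrightarrow> i \<in> I \<and> j \<in> I \<and> continuous_map (T j) (T i) (\<phi> i j)"
  shows "compact_space (limit_topology I r T \<phi>)"
proof -
  let ?P = "product_topology T I"
  have "compact_space ?P"
    using T by (auto simp: compact_space_product_topology finite_discrete_imp_compact)
  \<comment> \<open>An empty \<open>r\<close> is set apart because an intersection over the empty
    index set is the whole type and not \<open>topspace ?P\<close>.\<close>
  moreover have "closedin ?P (\<Inter>p\<in>r. topspace ?P \<inter> {x. \<phi> (fst p) (snd p) (x (snd p)) = x (fst p)})"
    if "r \<noteq> {}"
  proof (intro closedin_INT that)
    fix p assume p: "p \<in> r"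
    obtain i j where ij: "p = (i, j)" by fastforce
    have "closedin ?P {x \<in> topspace ?P. (\<phi> i j \<circ> (\<lambda>x. x j)) x = x i}"
    proof (rule closedin_continuous_maps_eq)
      show "Hausdorff_space (T i)"
        using T r p ij finite_discrete_imp_Hausdorff by blast
      show "continuous_map ?P (T i) (\<phi> i j \<circ> (\<lambda>x. x j))"
        using r p ij by (blast intro: continuous_map_compose continuous_map_product_projection)
      show "continuous_map ?P (T i) (\<lambda>x. x i)"
        using r p ij by (blast intro: continuous_map_product_projection)
    qed
    then show "closedin ?P (topspace ?P \<inter> {x. \<phi> (fst p) (snd p) (x (snd p)) = x (fst p)})"
      by (simp add: ij Collect_conj_eq)
  qed
  moreover have "topspace ?P \<inter> {x. \<forall>(i, j)\<in>r. \<phi> i j (x j) = x i} =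
      (if r = {} then topspace ?P
       else (\<Inter>p\<in>r. topspace ?P \<inter> {x. \<phi> (fst p) (snd p) (x (snd p)) = x (fst p)}))"
    by (cases "r = {}") (auto simp: split_beta simp del: topspace_product_topology)
  ultimately have "compactin ?P (topspace ?P \<inter> {x. \<forall>(i, j)\<in>r. \<phi> i j (x j) = x i})"
    by (simp add: closedin_compact_space compact_space_def del: topspace_product_topology)
  then have "compact_space
      (subtopology ?P (topspace ?P \<inter> {x. \<forall>(i, j)\<in>r. \<phi> i j (x j) = x i}))"
    by (rule compact_space_subtopology)
  then show ?thesis
    by (simp only: limit_topology_def subtopology_restrict)
qed

section \<open>Finite quotients of profinite semigroups\<close>

text \<open>The table \<open>t\<close> is not required to be associative; it is extensional so that there are only
  finitely many.\<close>

definition finite_quotients :: "nat \<Rightarrow> 'a top_semigroup \<Rightarrow> ('a \<Rightarrow> nat) set" where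
  "finite_quotients n S =
     {c \<in> extensional (sg_carrier S).
        continuous_map (sg_top S) (discrete_topology {..<n}) c \<and>
        (\<exists>t\<in>{..<n} \<times> {..<n} \<rightarrow>\<^sub>E {..<n}. \<forall>x\<in>sg_carrier S. \<forall>y\<in>sg_carrier S.
           c (sg_mult S x y) = t (c x, c y))}"

text \<open>A test is recovered from its table and its values on the generators: two tests sharing
  both agree on a subsemigroup containing the generators, hence on a dense set, hence everywhere
  because the values are discrete.\<close>

lemma finite_finite_quotients:
  assumes S: "topological_semigroup S" and "finitely_generated S"
  shows "finite (finite_quotients n S)"
proof -
  obtain A where A: "finite A" "A \<subseteq> sg_carrier S"
    and dense: "sg_top S closure_of (subsemigroup S hull A) = sg_carrier S"
    using assms(2) unfolding finitely_generated_def by blast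
  define P where "P t c \<longleftrightarrow> t \<in> {..<n} \<times> {..<n} \<rightarrow>\<^sub>E {..<n} \<and>
    (\<forall>x\<in>sg_carrier S. \<forall>y\<in>sg_carrier S. c (sg_mult S x y) = t (c x, c y))"
    for t and c :: "'a \<Rightarrow> nat"
  \<comment> \<open>A test that is not onto \<open>{..<n}\<close> may have several tables, so one is
    chosen. Equal codes then provide a common table.\<close>
  define T where "T c = (SOME t. P t c)" for c
  have PT: "P (T c) c" if "c \<in> finite_quotients n S" for c
    
  proof -
    have "\<exists>t. P t c"
      using that by (simp only: finite_quotients_def P_def Bex_def mem_Collect_eq)
    then show "P (T c) c"
      unfolding T_def by (rule someI_ex)
  qed
  let ?code = "\<lambda>c. (T c, restrict c A)"
  have "inj_on ?code (finite_quotients n S)"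
  proof (rule inj_onI)
    fix c d assume c: "c \<in> finite_quotients n S" and d: "d \<in> finite_quotients n S"
      and eq: "?code c = ?code d"
    let ?E = "{x \<in> sg_carrier S. c x = d x}"
    have "c x = d x" if "x \<in> A" for x
      using eq that by (metis prod.inject restrict_apply')
    then have "A \<subseteq> ?E"
      using A by blast
    \<comment> \<open>Both maps compute products with the same table, so their equalizer is closed
      under multiplication.\<close>
    moreover have "subsemigroup S ?E"
      using S PT[OF c] PT[OF d] eq
      by (auto simp: subsemigroup_def topological_semigroup_def P_def)
    ultimately have hull: "subsemigroup S hull A \<subseteq> ?E"
      by (rule hull_minimal)
    have "c x = d x" if "x \<in> sg_carrier S" for x
    proof (rule forall_in_closure_of_eq[where f = c and g = d and x = x])
      show "x \<in> sg_top S closure_of (subsemigroup S hull A)"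
        using dense that by simp
      show "Hausdorff_space (discrete_topology {..<n})"
        by simp
    qed (use c d hull in \<open>auto simp: finite_quotients_def\<close>)
    then show "c = d"
      using c d by (intro extensionalityI[of _ "sg_carrier S"]) (auto simp: finite_quotients_def)
  qed
  moreover have "?code ` finite_quotients n S \<subseteq>
      ({..<n} \<times> {..<n} \<rightarrow>\<^sub>E {..<n}) \<times> (A \<rightarrow>\<^sub>E {..<n})"
  proof (rule image_subsetI)
    fix c assume c: "c \<in> finite_quotients n S"
    then have "c \<in> sg_carrier S \<rightarrow> {..<n}"
      using continuous_map_funspace by (fastforce simp: finite_quotients_def)
    then have "restrict c A \<in> A \<rightarrow>\<^sub>E {..<n}"
      using A(2) by (intro restrict_PiE_iff[THEN iffD2]) blast
    with PT[OF c] show "?code c \<in> ({..<n} \<times> {..<n} \<rightarrow>\<^sub>E {..<n}) \<times> (A \<rightarrow>\<^sub>E {..<n})"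
      unfolding P_def by blast
  qed
  moreover have "finite (({..<n} \<times> {..<n} \<rightarrow>\<^sub>E {..<n}) \<times> (A \<rightarrow>\<^sub>E {..<n}))"
    using A by (auto intro!: finite_PiE)
  ultimately show ?thesis
    by (meson finite_imageD finite_subset)
qed

text \<open>The table of \<open>c\<close> also serves the composite, and the size \<open>n\<close>
  is kept because tests need not be onto. The equicontinuity of all homomorphisms rests on
  this.\<close>

lemma finite_quotients_compose:
  assumes S: "topological_semigroup S" and f: "continuous_sg_hom S R f"
    and c: "c \<in> finite_quotients n R"
  shows "compose (sg_carrier S) c f \<in> finite_quotients n S"
proof -
  have fR: "f x \<in> sg_carrier R" if "x \<in> sg_carrier S" for x
    using f that by (auto simp: continuous_sg_hom_def dest: continuous_map_funspace)
  have "continuous_map (sg_top S) (discrete_topology {..<n}) (c \<circ> f)"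
    using f c by (auto simp: continuous_sg_hom_def finite_quotients_def intro: continuous_map_compose)
  then have "continuous_map (sg_top S) (discrete_topology {..<n}) (compose (sg_carrier S) c f)"
    by (rule continuous_map_eq) (simp add: compose_def)
  moreover obtain t where "t \<in> {..<n} \<times> {..<n} \<rightarrow>\<^sub>E {..<n}"
    "\<forall>x\<in>sg_carrier R. \<forall>y\<in>sg_carrier R. c (sg_mult R x y) = t (c x, c y)"
    using c by (auto simp: finite_quotients_def)
  ultimately show ?thesis
    using S f fR
    by (auto simp: finite_quotients_def compose_def continuous_sg_hom_def topological_semigroup_def
        intro!: bexI[of _ t])
qed

text \<open>Trades the inverse system for tests: each coordinate of the limit is one. The carrier of
  a finite semigroup of the system is an arbitrary finite set of numbers, so it is only bounded by
  \<open>n\<close>, and its multiplication is extended to a total table on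
  \<open>{..<n}\<close>.\<close>

lemma profinite_semigroup_coordinates:
  fixes S :: "'a top_semigroup"
  assumes "profinite_semigroup S"
  obtains I r and T :: "('a \<times> 'a) set \<Rightarrow> nat topology" and \<phi> h
  where "\<And>i. i \<in> I \<Longrightarrow> finite_discrete (T i)"
    and "\<And>i j. (i, j) \<in> r \<Longrightarrow> i \<in> I \<and> j \<in> I \<and> continuous_map (T j) (T i) (\<phi> i j)"
    and "homeomorphic_map (sg_top S) (limit_topology I r T \<phi>) h"
    and "\<And>i. i \<in> I \<Longrightarrow> \<exists>n. topspace (T i) \<subseteq> {..<n} \<and>
           (\<lambda>x\<in>sg_carrier S. h x i) \<in> finite_quotients n S"
proof -
  obtain I r and X :: "('a \<times> 'a) set \<Rightarrow> nat top_semigroup" and \<phi> h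
    where sys: "sg_inverse_system I r X \<phi>"
      and fin: "\<forall>i\<in>I. finite_discrete (sg_top (X i))"
      and iso: "top_sg_iso S (sg_inverse_limit I r X \<phi>) h"
      and S: "topological_semigroup S"
    using assms unfolding profinite_semigroup_def by blast
  let ?T = "\<lambda>i. sg_top (X i)"
  let ?L = "limit_topology I r ?T \<phi>"
  have h: "homeomorphic_map (sg_top S) ?L h"
    and mult: "\<And>x y. x \<in> sg_carrier S \<Longrightarrow> y \<in> sg_carrier S \<Longrightarrow>
      h (sg_mult S x y) = (\<lambda>i\<in>I. sg_mult (X i) (h x i) (h y i))"
    using iso by (auto simp: top_sg_iso_def sg_inverse_limit_def continuous_sg_hom_def)
  show ?thesis
  proof
    show "finite_discrete (?T i)" if "i \<in> I" for i
      using fin that by blast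
    show "i \<in> I \<and> j \<in> I \<and> continuous_map (?T j) (?T i) (\<phi> i j)" if "(i, j) \<in> r" for i j
      using sys that
      by (auto simp: sg_inverse_system_def directed_set_def preorder_on_def continuous_sg_hom_def)
    show "homeomorphic_map (sg_top S) ?L h"
      by (rule h)
    fix i assume i: "i \<in> I"
    then have "finite (topspace (?T i))"
      using fin by (simp add: finite_discrete_def)
    then obtain m where m: "topspace (?T i) \<subseteq> {..<m}"
      using finite_nat_bounded by blast
    \<comment> \<open>The bound is made positive so that \<open>0\<close> can serve as the junk value of the table.\<close>
    define n where "n = Suc m"
    have n: "topspace (?T i) \<subseteq> {..<n}" "0 < n"
      using m by (auto simp: n_def)
    let ?c = "\<lambda>x\<in>sg_carrier S. h x i"
    let ?t = "\<lambda>(a, b)\<in>{..<n} \<times> {..<n}.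
      if a \<in> topspace (?T i) \<and> b \<in> topspace (?T i) then sg_mult (X i) a b else 0"
    have "continuous_map (sg_top S) (?T i) (\<lambda>x. h x i)"
      using homeomorphic_imp_continuous_map[OF h] i
      by (auto simp: limit_topology_def continuous_map_in_subtopology continuous_map_componentwise)
    then have hi: "continuous_map (sg_top S) (?T i) ?c"
      by (rule continuous_map_eq) simp
    have cT: "h x i \<in> topspace (?T i)" if "x \<in> sg_carrier S" for x
      using funcset_mem[OF continuous_map_funspace[OF hi] that] that by simp
    have "continuous_map (discrete_topology (topspace (?T i))) (discrete_topology {..<n}) (\<lambda>a. a)"
      using n by (auto simp: continuous_map_def)
    then have "continuous_map (?T i) (discrete_topology {..<n}) (\<lambda>a. a)"
      using fin i unfolding finite_discrete_def by metis
    then have cont: "continuous_map (sg_top S) (discrete_topology {..<n}) ?c"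
      using continuous_map_compose[OF hi] unfolding comp_def by blast
    have "topological_semigroup (X i)"
      using sys i by (auto simp: sg_inverse_system_def)
    then have t: "?t \<in> {..<n} \<times> {..<n} \<rightarrow>\<^sub>E {..<n}"
      using n by (fastforce simp: topological_semigroup_def split: if_splits)
    have eq: "?c (sg_mult S x y) = ?t (?c x, ?c y)"
      if "x \<in> sg_carrier S" "y \<in> sg_carrier S" for x y
    proof -
      have "sg_mult S x y \<in> sg_carrier S"
        using S that by (simp add: topological_semigroup_def)
      moreover have "h x i < n" "h y i < n"
        using cT n that by blast+
      ultimately show ?thesis
        using that cT i by (simp add: mult)
    qed
    have "?c \<in> finite_quotients n S"
      unfolding finite_quotients_def mem_Collect_eq
      by (intro conjI restrict_extensional cont bexI[OF _ t] ballI eq)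
    with n show "\<exists>n. topspace (?T i) \<subseteq> {..<n} \<and> ?c \<in> finite_quotients n S"
      by blast
  qed
qed

section \<open>Compactness, separation and continuity read off from the coordinates\<close>

lemma profinite_semigroup_compact:
  fixes S :: "'a top_semigroup"
  assumes "profinite_semigroup S"
  shows "compact_space (sg_top S)"
proof (rule profinite_semigroup_coordinates[OF assms])
  fix I r \<phi> h and T :: "('a \<times> 'a) set \<Rightarrow> nat topology"
  assume "\<And>i. i \<in> I \<Longrightarrow> finite_discrete (T i)"
    and "\<And>i j. (i, j) \<in> r \<Longrightarrow> i \<in> I \<and> j \<in> I \<and> continuous_map (T j) (T i) (\<phi> i j)"
    and h: "homeomorphic_map (sg_top S) (limit_topology I r T \<phi>) h"
  then have "compact_space (limit_topology I r T \<phi>)"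
    by (intro compact_limit_topology)
  then show ?thesis
    using homeomorphic_compact_space[OF homeomorphic_map_imp_homeomorphic_space[OF h]] by simp
qed

lemma profinite_semigroup_Hausdorff:
  fixes S :: "'a top_semigroup"
  assumes "profinite_semigroup S"
  shows "Hausdorff_space (sg_top S)"
proof (rule profinite_semigroup_coordinates[OF assms])
  fix I r \<phi> h and T :: "('a \<times> 'a) set \<Rightarrow> nat topology"
  assume "\<And>i. i \<in> I \<Longrightarrow> finite_discrete (T i)"
    and h: "homeomorphic_map (sg_top S) (limit_topology I r T \<phi>) h"
  then have "Hausdorff_space (limit_topology I r T \<phi>)"
    by (intro Hausdorff_limit_topology)
  then show ?thesis
    using homeomorphic_Hausdorff_space[OF homeomorphic_map_imp_homeomorphic_space[OF h]] by simp
qed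

text \<open>Points of the limit are extensional families, so distinct ones differ in some
  coordinate, and this coordinate is a test.\<close>

lemma finite_quotients_separate:
  fixes S :: "'a top_semigroup"
  assumes S: "profinite_semigroup S" and x: "x \<in> sg_carrier S" and y: "y \<in> sg_carrier S"
    and "x \<noteq> y"
  obtains n c where "c \<in> finite_quotients n S" "c x \<noteq> c y"
proof (rule profinite_semigroup_coordinates[OF S])
  fix I r and T :: "('a \<times> 'a) set \<Rightarrow> nat topology" and \<phi> h
  assume h: "homeomorphic_map (sg_top S) (limit_topology I r T \<phi>) h"
    and q: "\<And>i. i \<in> I \<Longrightarrow> \<exists>n. topspace (T i) \<subseteq> {..<n} \<and>
           (\<lambda>x\<in>sg_carrier S. h x i) \<in> finite_quotients n S"
  have "h x \<noteq> h y"
    using h assms by (metis homeomorphic_imp_injective_map inj_onD)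
  moreover have "h x \<in> extensional I" "h y \<in> extensional I"
    using homeomorphic_imp_surjective_map[OF h] x y
    by (auto simp: limit_topology_def PiE_def)
  ultimately obtain i where "i \<in> I" "h x i \<noteq> h y i"
    by (meson extensionalityI)
  moreover from q[OF this(1)] obtain n where "(\<lambda>x\<in>sg_carrier S. h x i) \<in> finite_quotients n S"
    by blast
  ultimately show thesis
    using x y that[of "\<lambda>x\<in>sg_carrier S. h x i" n] by simp
qed

text \<open>The limit carries the initial topology of its coordinates, so tests detect continuity.
  Together with compactness, the Hausdorff property and the separation of points by tests, this is
  all that later arguments use of the inverse system.\<close>

lemma continuous_map_into_profinite_semigroup:
  fixes S :: "'a top_semigroup"
  assumes S: "profinite_semigroup S"
    and f: "\<And>y. y \<in> topspace Y \<Longrightarrow> f y \<in> sg_carrier S"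
    and cont: "\<And>n c. c \<in> finite_quotients n S \<Longrightarrow>
      continuous_map Y (discrete_topology {..<n}) (\<lambda>y. c (f y))"
  shows "continuous_map Y (sg_top S) f"
proof (rule profinite_semigroup_coordinates[OF S])
  fix I r and T :: "('a \<times> 'a) set \<Rightarrow> nat topology" and \<phi> h
  assume T: "\<And>i. i \<in> I \<Longrightarrow> finite_discrete (T i)"
    and h: "homeomorphic_map (sg_top S) (limit_topology I r T \<phi>) h"
    and q: "\<And>i. i \<in> I \<Longrightarrow> \<exists>n. topspace (T i) \<subseteq> {..<n} \<and>
           (\<lambda>x\<in>sg_carrier S. h x i) \<in> finite_quotients n S"
  let ?L = "limit_topology I r T \<phi>"
  obtain g where g: "homeomorphic_maps (sg_top S) ?L h g"
    using h homeomorphic_map_maps by blast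
  have hf: "h (f y) \<in> topspace ?L" if "y \<in> topspace Y" for y
    using homeomorphic_imp_surjective_map[OF h] f that by blast
  have "continuous_map Y (T i) (\<lambda>y. h (f y) i)" if i: "i \<in> I" for i
  proof -
    obtain n where n: "(\<lambda>x\<in>sg_carrier S. h x i) \<in> finite_quotients n S"
      using q i by blast
    have "continuous_map Y (discrete_topology {..<n}) (\<lambda>y. h (f y) i)"
      using cont[OF n] by (rule continuous_map_eq) (simp add: f)
    \<comment> \<open>The values lie in \<open>topspace (T i)\<close>; openness of the fibres allows
      this set to replace \<open>{..<n}\<close> as the discrete target.\<close>
    note fibre = openin_discrete_fibre[OF this]
    have "continuous_map Y (discrete_topology (topspace (T i))) (\<lambda>y. h (f y) i)"
    proof (rule continuous_map_discrete_topologyI)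
      fix y assume y: "y \<in> topspace Y"
      show "h (f y) i \<in> topspace (T i)"
        using hf[OF y] i by (auto simp: limit_topology_def)
      show "\<exists>U. openin Y U \<and> y \<in> U \<and> (\<forall>z\<in>U. h (f z) i = h (f y) i)"
        using fibre[of "h (f y) i"] y by fastforce
    qed
    then show ?thesis
      using T[OF i] by (simp add: finite_discrete_def)
  qed
  then have "continuous_map Y ?L (\<lambda>y. h (f y))"
    using hf by (auto simp: limit_topology_def continuous_map_in_subtopology
        continuous_map_componentwise PiE_def)
  then have "continuous_map Y (sg_top S) (g \<circ> (\<lambda>y. h (f y)))"
    using g by (auto simp: homeomorphic_maps_def intro: continuous_map_compose)
  then show ?thesis
    by (rule continuous_map_eq) (use g f in \<open>auto simp: homeomorphic_maps_def\<close>)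
qed

section \<open>Open congruences and profinite categories\<close>

lemma discrete_topological_category:
  assumes "is_category C" "ob_top C = discrete_topology V" "mor_top C = discrete_topology W"
  shows "topological_category C"
proof -
  have "subtopology (prod_topology (mor_top C) (mor_top C)) (composable_pairs C) =
      discrete_topology (composable_pairs C)"
    using assms(3)
    by (auto simp: composable_pairs_def simp flip: prod_topology_discrete_topology
        intro!: arg_cong[where f = discrete_topology])
  then show ?thesis
    using assms
    by (auto simp: topological_category_def is_category_def)
qed

text \<open>Only parallel morphisms are related, so a quotient keeps all objects. Composability is
  asked of \<open>(g, f)\<close> alone, because \<open>(g', f')\<close> is then composable as
  well.\<close>

definition open_congruence :: "('o, 'm) top_category \<Rightarrow> ('m \<times> 'm) set \<Rightarrow> bool" where
  "open_congruence C E \<longleftrightarrow>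
     equiv (cat_mor C) E \<and>
     (\<forall>(f, g)\<in>E. cat_dom C f = cat_dom C g \<and> cat_cod C f = cat_cod C g) \<and>
     (\<forall>g f g' f'. (g, f) \<in> composable_pairs C \<longrightarrow> (g, g') \<in> E \<longrightarrow> (f, f') \<in> E \<longrightarrow>
        (cat_comp C g f, cat_comp C g' f') \<in> E) \<and>
     (\<forall>f\<in>cat_mor C. openin (mor_top C) (E `` {f}))"

lemma open_congruence_Int:
  assumes "open_congruence C E" "open_congruence C E'"
  shows "open_congruence C (E \<inter> E')"
proof -
  have "equiv (cat_mor C) E" "equiv (cat_mor C) E'"
    using assms by (simp_all add: open_congruence_def)
  then have "equiv (cat_mor C) (E \<inter> E')"
    unfolding equiv_def refl_on_def by (auto intro: sym_Int trans_Int)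
  moreover have "openin (mor_top C) ((E \<inter> E') `` {f})" if "f \<in> cat_mor C" for f
  proof -
    have "(E \<inter> E') `` {f} = E `` {f} \<inter> E' `` {f}"
      by blast
    then show ?thesis
      using assms that by (simp add: open_congruence_def openin_Int)
  qed
  ultimately show ?thesis
    using assms unfolding open_congruence_def by blast
qed

text \<open>This is the coarsest open congruence, and it makes the index set of the inverse system
  nonempty. Its classes are open because domain and codomain are continuous maps into a discrete
  space.\<close>

lemma open_congruence_parallel:
  assumes C: "topological_category C" and ob: "ob_top C = discrete_topology V"
  shows "open_congruence C
    {(f, g). f \<in> cat_mor C \<and> g \<in> cat_mor C \<and> cat_dom C f = cat_dom C g \<and> cat_cod C f = cat_cod C g}"
    (is "open_congruence C ?E")
proof -
  have "openin (mor_top C) (?E `` {f})" if "f \<in> cat_mor C" for f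
  proof -
    have "?E `` {f} = {g \<in> cat_mor C. cat_dom C g = cat_dom C f} \<inter>
        {g \<in> cat_mor C. cat_cod C g = cat_cod C f}"
      using that by auto
    then show ?thesis
      using C unfolding topological_category_def ob
      by (auto intro: openin_Int openin_discrete_fibre)
  qed
  moreover have "(cat_comp C g f, cat_comp C g' f') \<in> ?E"
    if "(g, f) \<in> composable_pairs C" "(g, g') \<in> ?E" "(f, f') \<in> ?E" for g f g' f'
  proof -
    have "(g', f') \<in> composable_pairs C"
      using that by (auto simp: composable_pairs_def)
    moreover have "cat_comp C k h \<in> cat_mor C \<and>
        cat_dom C (cat_comp C k h) = cat_dom C h \<and> cat_cod C (cat_comp C k h) = cat_cod C k"
      if "(k, h) \<in> composable_pairs C" for k h
      using C that by (auto simp: topological_category_def is_category_def)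
    ultimately show ?thesis
      using that by simp
  qed
  moreover have "equiv (cat_mor C) ?E"
    unfolding equiv_def refl_on_def sym_on_def trans_on_def by auto
  ultimately show ?thesis
    unfolding open_congruence_def by blast
qed

text \<open>The classes form an open cover by disjoint nonempty sets, and a finite subcover of such
  a cover contains every class.\<close>

lemma open_congruence_finite_index:
  assumes "compact_space (mor_top C)" and E: "open_congruence C E"
  shows "finite (cat_mor C // E)"
proof -
  have eq: "equiv (cat_mor C) E"
    using E by (simp add: open_congruence_def)
  have "\<forall>U\<in>cat_mor C // E. openin (mor_top C) U"
    using E by (auto simp: open_congruence_def quotient_def)
  moreover have "cat_mor C \<subseteq> \<Union> (cat_mor C // E)"
    by (simp add: Union_quotient[OF eq])
  ultimately obtain \<F> where \<F>: "finite \<F>" "\<F> \<subseteq> cat_mor C // E" "cat_mor C \<subseteq> \<Union>\<F>"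
    using assms(1) unfolding compact_space_alt by meson
  have "U \<in> \<F>" if U: "U \<in> cat_mor C // E" for U
  proof -
    obtain f where f: "f \<in> U" "f \<in> cat_mor C"
      using in_quotient_imp_non_empty[OF eq U] in_quotient_imp_subset[OF eq U] by blast
    then obtain W where "W \<in> \<F>" "f \<in> W"
      using \<F> by blast
    then show ?thesis
      using quotient_disj[OF eq U] \<F> f by blast
  qed
  then show ?thesis
    using \<F> by (meson finite_subset subsetI)
qed

section \<open>Quotient categories on natural numbers\<close>

definition quotient_category ::
  "('o, 'm) top_category \<Rightarrow> ('o \<Rightarrow> nat) \<Rightarrow> ('m \<Rightarrow> nat) \<Rightarrow> (nat, nat) top_category" where
  "quotient_category C e l =
     (let s = inv_into (cat_mor C) l in
      \<lparr> ob_top = discrete_topology (e ` cat_ob C),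
        mor_top = discrete_topology (l ` cat_mor C),
        cat_dom = (\<lambda>m. e (cat_dom C (s m))),
        cat_cod = (\<lambda>m. e (cat_cod C (s m))),
        cat_comp = (\<lambda>n m. l (cat_comp C (s n) (s m))),
        cat_id = (\<lambda>q. l (cat_id C (inv_into (cat_ob C) e q))) \<rparr>)"

lemma quotient_category_simps [simp]:
  "ob_top (quotient_category C e l) = discrete_topology (e ` cat_ob C)"
  "mor_top (quotient_category C e l) = discrete_topology (l ` cat_mor C)"
  by (simp_all add: quotient_category_def Let_def)

text \<open>The labelling \<open>l\<close> numbers the classes of \<open>E\<close>, while
  \<open>e\<close> merely renames the objects, since \<open>profinite_category\<close> asks for
  categories on natural numbers. The operations of the quotient are computed on representatives
  chosen by \<open>s\<close>; the equations proved here show that the choice is immaterial.\<close>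

locale congruence_labelling =
  fixes C :: "('o, 'm) top_category" and E :: "('m \<times> 'm) set"
    and e :: "'o \<Rightarrow> nat" and l :: "'m \<Rightarrow> nat"
  assumes cat: "is_category C"
    and cong: "open_congruence C E"
    and inj: "inj_on e (cat_ob C)"
    and label: "\<And>f g. f \<in> cat_mor C \<Longrightarrow> g \<in> cat_mor C \<Longrightarrow> l f = l g \<longleftrightarrow> (f, g) \<in> E"
begin

abbreviation "Q \<equiv> quotient_category C e l"
abbreviation "s \<equiv> inv_into (cat_mor C) l"

lemma representative:
  assumes "f \<in> cat_mor C"
  shows "s (l f) \<in> cat_mor C" "(s (l f), f) \<in> E"
    "cat_dom C (s (l f)) = cat_dom C f" "cat_cod C (s (l f)) = cat_cod C f"
proof -
  show s: "s (l f) \<in> cat_mor C"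
    using assms by (auto intro: inv_into_into)
  have "l (s (l f)) = l f"
    using assms by (auto intro: f_inv_into_f)
  then show "(s (l f), f) \<in> E"
    using label[OF s assms] by simp
  then show "cat_dom C (s (l f)) = cat_dom C f" "cat_cod C (s (l f)) = cat_cod C f"
    using cong by (auto simp: open_congruence_def)
qed

lemma quotient_dom: "f \<in> cat_mor C \<Longrightarrow> cat_dom Q (l f) = e (cat_dom C f)"
  by (simp add: quotient_category_def Let_def representative)

lemma quotient_cod: "f \<in> cat_mor C \<Longrightarrow> cat_cod Q (l f) = e (cat_cod C f)"
  by (simp add: quotient_category_def Let_def representative)

lemma quotient_id: "q \<in> cat_ob C \<Longrightarrow> cat_id Q (e q) = l (cat_id C q)"
  by (simp add: quotient_category_def Let_def inj inv_into_f_f)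

lemma comp_mor: "(g, f) \<in> composable_pairs C \<Longrightarrow> cat_comp C g f \<in> cat_mor C"
  using cat by (auto simp: is_category_def)

lemma quotient_comp:
  assumes gf: "(g, f) \<in> composable_pairs C"
  shows "cat_comp Q (l g) (l f) = l (cat_comp C g f)"
proof -
  have g: "g \<in> cat_mor C" and f: "f \<in> cat_mor C"
    using gf by (auto simp: composable_pairs_def)
  have sgf: "(s (l g), s (l f)) \<in> composable_pairs C"
    using gf representative[OF g] representative[OF f] by (auto simp: composable_pairs_def)
  then have "(cat_comp C (s (l g)) (s (l f)), cat_comp C g f) \<in> E"
    using cong representative(2)[OF g] representative(2)[OF f]
    unfolding open_congruence_def by blast
  then show ?thesis
    using label[OF comp_mor[OF sgf] comp_mor[OF gf]]
    by (simp add: quotient_category_def Let_def)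
qed

text \<open>Because \<open>e\<close> is injective, composable labels come from morphisms that are
  already composable in \<open>C\<close>, and every composite in the quotient is the label of a
  composite of \<open>C\<close>.\<close>

lemma quotient_composable:
  assumes "(n, m) \<in> composable_pairs Q"
  obtains g f where "n = l g" "m = l f" "(g, f) \<in> composable_pairs C"
proof -
  obtain g f where gf: "g \<in> cat_mor C" "f \<in> cat_mor C" "n = l g" "m = l f"
    using assms by (auto simp: composable_pairs_def)
  moreover have "e (cat_dom C g) = e (cat_cod C f)"
    using assms gf by (simp add: composable_pairs_def quotient_dom quotient_cod)
  then have "cat_dom C g = cat_cod C f"
    using inj cat gf unfolding is_category_def by (meson inj_onD)
  ultimately show thesis
    using that by (auto simp: composable_pairs_def)
qed

lemma is_category_quotient: "is_category Q"
  unfolding is_category_def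
proof (intro conjI)
  have C: "\<And>f. f \<in> cat_mor C \<Longrightarrow> cat_dom C f \<in> cat_ob C \<and> cat_cod C f \<in> cat_ob C"
    "\<And>q. q \<in> cat_ob C \<Longrightarrow> cat_id C q \<in> cat_mor C \<and> cat_dom C (cat_id C q) = q \<and> cat_cod C (cat_id C q) = q"
    "\<And>g f. (g, f) \<in> composable_pairs C \<Longrightarrow> cat_dom C (cat_comp C g f) = cat_dom C f \<and>
        cat_cod C (cat_comp C g f) = cat_cod C g"
    "\<And>f. f \<in> cat_mor C \<Longrightarrow> cat_comp C f (cat_id C (cat_dom C f)) = f \<and>
        cat_comp C (cat_id C (cat_cod C f)) f = f"
    "\<And>h g f. (h, g) \<in> composable_pairs C \<Longrightarrow> (g, f) \<in> composable_pairs C \<Longrightarrow>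
        cat_comp C (cat_comp C h g) f = cat_comp C h (cat_comp C g f)"
    using cat by (auto simp: is_category_def)
  show "\<forall>f\<in>cat_mor Q. cat_dom Q f \<in> cat_ob Q \<and> cat_cod Q f \<in> cat_ob Q"
    by (auto simp: quotient_dom quotient_cod C)
  show "\<forall>q\<in>cat_ob Q. cat_id Q q \<in> cat_mor Q \<and> cat_dom Q (cat_id Q q) = q \<and> cat_cod Q (cat_id Q q) = q"
    by (auto simp: quotient_dom quotient_cod quotient_id C)
  show "\<forall>(n, m)\<in>composable_pairs Q. cat_comp Q n m \<in> cat_mor Q \<and>
      cat_dom Q (cat_comp Q n m) = cat_dom Q m \<and> cat_cod Q (cat_comp Q n m) = cat_cod Q n"
  proof (clarify)
    fix n m assume "(n, m) \<in> composable_pairs Q"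
    then obtain g f where gf: "n = l g" "m = l f" "(g, f) \<in> composable_pairs C"
      by (rule quotient_composable)
    then have "g \<in> cat_mor C" "f \<in> cat_mor C"
      by (auto simp: composable_pairs_def)
    then show "cat_comp Q n m \<in> cat_mor Q \<and>
        cat_dom Q (cat_comp Q n m) = cat_dom Q m \<and> cat_cod Q (cat_comp Q n m) = cat_cod Q n"
      using gf comp_mor[OF gf(3)] C(3)[OF gf(3)]
      by (simp add: quotient_comp quotient_dom quotient_cod)
  qed
  show "\<forall>f\<in>cat_mor Q. cat_comp Q f (cat_id Q (cat_dom Q f)) = f \<and> cat_comp Q (cat_id Q (cat_cod Q f)) f = f"
  proof
    fix m assume "m \<in> cat_mor Q"
    then obtain f where f: "f \<in> cat_mor C" "m = l f"
      by auto
    have "(f, cat_id C (cat_dom C f)) \<in> composable_pairs C"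
      "(cat_id C (cat_cod C f), f) \<in> composable_pairs C"
      using f C(1)[OF f(1)] C(2) by (auto simp: composable_pairs_def)
    from this[THEN quotient_comp]
    show "cat_comp Q m (cat_id Q (cat_dom Q m)) = m \<and> cat_comp Q (cat_id Q (cat_cod Q m)) m = m"
      using f C(1,4)[OF f(1)] by (simp add: quotient_dom quotient_cod quotient_id)
  qed
  show "\<forall>h g f. (h, g) \<in> composable_pairs Q \<longrightarrow> (g, f) \<in> composable_pairs Q \<longrightarrow>
      cat_comp Q (cat_comp Q h g) f = cat_comp Q h (cat_comp Q g f)"
  proof (intro allI impI)
    fix k n m assume kn: "(k, n) \<in> composable_pairs Q" and nm: "(n, m) \<in> composable_pairs Q"
    obtain h g where hg: "k = l h" "n = l g" "(h, g) \<in> composable_pairs C"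
      using kn by (rule quotient_composable)
    obtain g' f where gf: "n = l g'" "m = l f" "(g', f) \<in> composable_pairs C"
      using nm by (rule quotient_composable)
    have "h \<in> cat_mor C" "g \<in> cat_mor C" "g' \<in> cat_mor C" "f \<in> cat_mor C"
      using hg gf by (auto simp: composable_pairs_def)
    \<comment> \<open>The two lifts share only the label of the middle morphism. Being congruent,
      \<open>g\<close> and \<open>g'\<close> are parallel, so \<open>g\<close> can take the place of
      \<open>g'\<close> and a composable triple results.\<close>
    moreover from this have "(g, g') \<in> E"
      using label[of g g'] hg gf by metis
    then have "cat_dom C g = cat_dom C g'"
      using cong by (auto simp: open_congruence_def)
    ultimately have gf': "(g, f) \<in> composable_pairs C"
      using gf by (auto simp: composable_pairs_def)
    have "(cat_comp C h g, f) \<in> composable_pairs C" "(h, cat_comp C g f) \<in> composable_pairs C"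
      using gf' hg comp_mor[OF gf'] comp_mor[OF hg(3)] C(3)[OF gf'] C(3)[OF hg(3)]
      by (auto simp: composable_pairs_def)
    then show "cat_comp Q (cat_comp Q k n) m = cat_comp Q k (cat_comp Q n m)"
      using hg gf gf' C(5)[OF hg(3) gf'] by (simp add: quotient_comp)
  qed
qed

end

text \<open>As \<open>E'\<close> refines \<open>E\<close>, the label of a class of \<open>E'\<close>
  determines the label of the class of \<open>E\<close> containing it. Both quotients name objects
  by the same \<open>e\<close>, hence the identity on objects.\<close>

lemma continuous_functor_between_quotients:
  assumes "congruence_labelling C E e l" and "congruence_labelling C E' e l'" and "E' \<subseteq> E"
  shows "continuous_functor (quotient_category C e l') (quotient_category C e l)
    (\<lambda>q. q) (\<lambda>m. l (inv_into (cat_mor C) l' m))"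
    and "\<And>f. f \<in> cat_mor C \<Longrightarrow> l (inv_into (cat_mor C) l' (l' f)) = l f"
proof -
  interpret Q: congruence_labelling C E e l by fact
  interpret Q': congruence_labelling C E' e l' by fact
  show eq: "l (Q'.s (l' f)) = l f" if "f \<in> cat_mor C" for f
    using Q.label Q'.representative(1,2)[OF that] that assms(3) by blast
  have mor: "cat_dom Q.Q (l (Q'.s m)) = cat_dom Q'.Q m \<and> cat_cod Q.Q (l (Q'.s m)) = cat_cod Q'.Q m"
    if "m \<in> cat_mor Q'.Q" for m
    using that by (auto simp: eq Q.quotient_dom Q.quotient_cod Q'.quotient_dom Q'.quotient_cod)
  have id: "l (Q'.s (cat_id Q'.Q q)) = cat_id Q.Q q" if "q \<in> cat_ob Q'.Q" for q
    using that Q.cat by (auto simp: eq Q.quotient_id Q'.quotient_id is_category_def)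
  have comp: "l (Q'.s (cat_comp Q'.Q n m)) = cat_comp Q.Q (l (Q'.s n)) (l (Q'.s m))"
    if nm: "(n, m) \<in> composable_pairs Q'.Q" for n m
  proof -
    obtain g f where gf: "n = l' g" "m = l' f" "(g, f) \<in> composable_pairs C"
      using nm by (rule Q'.quotient_composable)
    then have "g \<in> cat_mor C" "f \<in> cat_mor C"
      by (auto simp: composable_pairs_def)
    with gf show ?thesis
      by (simp add: eq Q.comp_mor Q.quotient_comp Q'.quotient_comp)
  qed
  show "continuous_functor Q'.Q Q.Q (\<lambda>q. q) (\<lambda>m. l (Q'.s m))"
    using mor id comp by (auto simp: continuous_functor_def eq)
qed

text \<open>The inverse system consists of the quotients by all open congruences, ordered by reverse
  inclusion; compactness makes the comparison map onto its limit surjective.\<close>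

theorem profinite_category_if_separated:
  fixes C :: "('o, 'm) top_category"
  assumes C: "topological_category C"
    and ob: "ob_top C = discrete_topology V" "finite V"
    and compact: "compact_space (mor_top C)"
    and sep: "\<And>f g. f \<in> cat_mor C \<Longrightarrow> g \<in> cat_mor C \<Longrightarrow> f \<noteq> g \<Longrightarrow>
      \<exists>E. open_congruence C E \<and> (f, g) \<notin> E"
  shows "profinite_category C"
proof -
  have cat: "is_category C"
    using C by (simp add: topological_category_def)
  obtain e :: "'o \<Rightarrow> nat" where e: "inj_on e (cat_ob C)"
    using finite_imp_inj_to_nat_seg[of "cat_ob C"] ob by auto
  \<comment> \<open>Compactness leaves only finitely many classes, which can therefore be
    numbered.\<close>
  have "\<exists>l :: 'm \<Rightarrow> nat. finite (l ` cat_mor C) \<and>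
      (\<forall>f\<in>cat_mor C. \<forall>g\<in>cat_mor C. l f = l g \<longleftrightarrow> (f, g) \<in> E)"
    if E: "open_congruence C E" for E
  proof -
    have eq: "equiv (cat_mor C) E"
      using E unfolding open_congruence_def by (rule conjunct1)
    note fin = open_congruence_finite_index[OF compact E]
    obtain k :: "'m set \<Rightarrow> nat" where k: "inj_on k (cat_mor C // E)"
      using finite_imp_inj_to_nat_seg[OF fin] by blast
    have "k (E `` {f}) = k (E `` {g}) \<longleftrightarrow> (f, g) \<in> E" if "f \<in> cat_mor C" "g \<in> cat_mor C" for f g
      using inj_on_eq_iff[OF k quotientI quotientI, of f g] eq_equiv_class_iff[OF eq, of f g] that
      by blast
    moreover have "(\<lambda>f. k (E `` {f})) ` cat_mor C \<subseteq> k ` (cat_mor C // E)"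
      by (blast intro: quotientI)
    then have "finite ((\<lambda>f. k (E `` {f})) ` cat_mor C)"
      using fin by (meson finite_imageI finite_subset)
    ultimately show ?thesis
      by (intro exI[of _ "\<lambda>f. k (E `` {f})"]) simp
  qed
  then obtain l :: "('m \<times> 'm) set \<Rightarrow> 'm \<Rightarrow> nat"
    where l: "\<And>E f g. open_congruence C E \<Longrightarrow> f \<in> cat_mor C \<Longrightarrow> g \<in> cat_mor C \<Longrightarrow>
      l E f = l E g \<longleftrightarrow> (f, g) \<in> E"
      and finite_l: "\<And>E. open_congruence C E \<Longrightarrow> finite (l E ` cat_mor C)"
    by metis
  \<comment> \<open>The congruences themselves serve as indices, which matches the index type
    \<open>('m \<times> 'm) set\<close> in \<open>profinite_category\<close>.\<close>
  define I where "I = {E. open_congruence C E}"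
  define r where "r = {(E, E'). E \<in> I \<and> E' \<in> I \<and> E' \<subseteq> E}"
  define X where "X E = quotient_category C e (l E)" for E
  define \<psi> where "\<psi> E E' m = l E (inv_into (cat_mor C) (l E') m)" for E E' m
  let ?\<phi> = "\<lambda>(_::('m \<times> 'm) set) (_::('m \<times> 'm) set) (q::nat). q"
  let ?L = "cat_inverse_limit I r X ?\<phi> \<psi>"
  have lab: "congruence_labelling C E e (l E)" if "E \<in> I" for E
    using that cat e l by unfold_locales (auto simp: I_def)
  have \<psi>: "\<psi> E E' (l E' f) = l E f" if "(E, E') \<in> r" "f \<in> cat_mor C" for E E' f
    using continuous_functor_between_quotients(2)[OF lab lab] that by (simp add: r_def \<psi>_def)
  have directed: "directed_set I r"
    unfolding directed_set_def
  proof (intro conjI ballI)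
    show "I \<noteq> {}"
      using open_congruence_parallel[OF C ob(1)] by (auto simp: I_def)
    show "preorder_on I r"
      by (auto simp: preorder_on_def r_def refl_on_def trans_def)
    show "\<exists>k\<in>I. (i, k) \<in> r \<and> (j, k) \<in> r" if "i \<in> I" "j \<in> I" for i j
      using that open_congruence_Int[of C i j] by (intro bexI[of _ "i \<inter> j"]) (auto simp: r_def I_def)
  qed
  \<comment> \<open>Upper bounds for \<open>r\<close> are lower bounds for inclusion. Finite sets of
    indices arise from the finite intersection property behind the surjectivity of
    \<open>\<beta>\<close>.\<close>
  have lower: "\<exists>E\<in>I. \<forall>E'\<in>J. (E', E) \<in> r" if "finite J" "J \<subseteq> I" for J
    using that
  proof (induction J)
    case empty
    then show ?case
      using directed by (auto simp: directed_set_def)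
  next
    case (insert E' J)
    then obtain E where "E \<in> I" "\<forall>E'\<in>J. (E', E) \<in> r"
      by blast
    moreover obtain E'' where "E'' \<in> I" "(E', E'') \<in> r" "(E, E'') \<in> r"
      using directed insert.prems \<open>E \<in> I\<close> unfolding directed_set_def by blast
    moreover have "trans r"
      using directed by (simp add: directed_set_def preorder_on_def)
    ultimately show ?case
      unfolding trans_def by blast
  qed
  have system: "cat_inverse_system I r X ?\<phi> \<psi>"
    unfolding cat_inverse_system_def
  proof (intro conjI)
    show "\<forall>i\<in>I. topological_category (X i)"
      unfolding X_def
      by (blast intro: discrete_topological_category quotient_category_simps
          congruence_labelling.is_category_quotient lab)
    show "\<forall>(i, j)\<in>r. continuous_functor (X j) (X i) (?\<phi> i j) (\<psi> i j)"
      using continuous_functor_between_quotients(1)[OF lab lab]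
      by (auto simp: r_def X_def \<psi>_def[abs_def])
    show "functorial_system I r (\<lambda>i. ob_top (X i)) ?\<phi>"
      by (simp add: functorial_system_def)
    show "functorial_system I r (\<lambda>i. mor_top (X i)) \<psi>"
      unfolding functorial_system_def
    proof (intro conjI allI impI ballI)
      fix i m assume "i \<in> I" "m \<in> cat_mor (X i)"
      then obtain f where "f \<in> cat_mor C" "m = l i f" "(i, i) \<in> r"
        by (auto simp: X_def r_def)
      then show "\<psi> i i m = m"
        by (simp add: \<psi>)
    next
      fix i j k m assume ijk: "(i, j) \<in> r" "(j, k) \<in> r" and "m \<in> cat_mor (X k)"
      then obtain f where "f \<in> cat_mor C" "m = l k f"
        by (auto simp: X_def)
      moreover have "(i, k) \<in> r"
        using ijk by (auto simp: r_def)
      ultimately show "\<psi> i j (\<psi> j k m) = \<psi> i k m"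
        using ijk by (simp add: \<psi>)
    qed
  qed (rule directed)
  have fin: "finite_discrete (ob_top (X i)) \<and> finite_discrete (mor_top (X i))" if "i \<in> I" for i
    using that ob finite_l by (simp add: X_def I_def finite_discrete_def)
  define \<alpha> where "\<alpha> q = (\<lambda>i\<in>I. e q)" for q
  define \<beta> where "\<beta> f = (\<lambda>i\<in>I. l i f)" for f
  have obL: "ob_top ?L = limit_topology I r (\<lambda>i. ob_top (X i)) ?\<phi>"
    and morL: "mor_top ?L = limit_topology I r (\<lambda>i. mor_top (X i)) \<psi>"
    by (simp_all add: cat_inverse_limit_def)
  have Haus: "Hausdorff_space (ob_top ?L)" "Hausdorff_space (mor_top ?L)"
    unfolding obL morL using fin by (blast intro: Hausdorff_limit_topology)+
  have "r \<subseteq> I \<times> I"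
    by (auto simp: r_def)
  have cont\<alpha>: "continuous_map (ob_top C) (ob_top ?L) \<alpha>"
    unfolding obL limit_topology_def continuous_map_in_subtopology continuous_map_componentwise
  proof (intro conjI ballI)
    show "\<alpha> ` cat_ob C \<subseteq> extensional I"
      by (auto simp: \<alpha>_def)
    show "\<alpha> \<in> cat_ob C \<rightarrow> {x. \<forall>(i, j)\<in>r. x j = x i}"
      using \<open>r \<subseteq> I \<times> I\<close> by (auto simp: \<alpha>_def)
    show "continuous_map (ob_top C) (ob_top (X i)) (\<lambda>x. \<alpha> x i)" if "i \<in> I" for i
      using that ob by (simp add: \<alpha>_def X_def)
  qed
  have cont\<beta>: "continuous_map (mor_top C) (mor_top ?L) \<beta>"
    unfolding morL limit_topology_def continuous_map_in_subtopology continuous_map_componentwise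
  proof (intro conjI ballI)
    show "\<beta> ` cat_mor C \<subseteq> extensional I"
      by (auto simp: \<beta>_def)
    show "\<beta> \<in> cat_mor C \<rightarrow> {x. \<forall>(i, j)\<in>r. \<psi> i j (x j) = x i}"
      using \<open>r \<subseteq> I \<times> I\<close> by (auto simp: \<beta>_def \<psi>)
    fix i assume i: "i \<in> I"
    have "continuous_map (mor_top C) (discrete_topology (l i ` cat_mor C)) (l i)"
    proof (rule continuous_map_discrete_topologyI)
      fix f assume f: "f \<in> cat_mor C"
      have "equiv (cat_mor C) i" "openin (mor_top C) (i `` {f})"
        using i f by (auto simp: I_def open_congruence_def)
      moreover have "l i g = l i f" if "(f, g) \<in> i" for g
        using l[of i f g] equiv_type[OF calculation(1)] i that by (auto simp: I_def)
      ultimately show "\<exists>U. openin (mor_top C) U \<and> f \<in> U \<and> (\<forall>z\<in>U. l i z = l i f)"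
        using equiv_class_self f by (intro exI[of _ "i `` {f}"]) auto
    qed auto
    then show "continuous_map (mor_top C) (mor_top (X i)) (\<lambda>x. \<beta> x i)"
      using i by (simp add: \<beta>_def X_def)
  qed
  have surj\<alpha>: "\<alpha> ` cat_ob C = cat_ob ?L"
  proof
    show "\<alpha> ` cat_ob C \<subseteq> cat_ob ?L"
      using continuous_map_image_subset_topspace[OF cont\<alpha>] .
    show "cat_ob ?L \<subseteq> \<alpha> ` cat_ob C"
    proof
      fix x assume "x \<in> cat_ob ?L"
      then have x: "x \<in> (\<Pi>\<^sub>E i\<in>I. e ` cat_ob C)" "\<And>i j. (i, j) \<in> r \<Longrightarrow> x j = x i"
        by (auto simp: obL limit_topology_def X_def)
      obtain i where i: "i \<in> I"
        using directed by (auto simp: directed_set_def)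
      then obtain q where q: "q \<in> cat_ob C" "x i = e q"
        using x(1) by (auto simp: PiE_def Pi_def)
      \<comment> \<open>The bonding maps on objects are identities, so a common upper bound of
        \<open>i\<close> and \<open>j\<close> forces \<open>x j = x i\<close>.\<close>
      have "x j = e q" if j: "j \<in> I" for j
        using directed i j q x(2) unfolding directed_set_def by metis
      then have "x = \<alpha> q"
        using x(1) by (auto simp: \<alpha>_def PiE_def extensional_def fun_eq_iff)
      then show "x \<in> \<alpha> ` cat_ob C"
        using q by blast
    qed
  qed
  have inj\<alpha>: "inj_on \<alpha> (cat_ob C)"
  proof (rule inj_onI)
    fix p q assume pq: "p \<in> cat_ob C" "q \<in> cat_ob C" "\<alpha> p = \<alpha> q"
    obtain i where "i \<in> I"
      using directed by (auto simp: directed_set_def)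
    then have "e p = e q"
      using fun_cong[OF pq(3), of i] by (simp add: \<alpha>_def)
    then show "p = q"
      using e pq by (simp add: inj_on_eq_iff)
  qed
  have surj\<beta>: "\<beta> ` cat_mor C = cat_mor ?L"
  proof
    show "\<beta> ` cat_mor C \<subseteq> cat_mor ?L"
      using continuous_map_image_subset_topspace[OF cont\<beta>] .
    show "cat_mor ?L \<subseteq> \<beta> ` cat_mor C"
    proof
      fix x assume "x \<in> cat_mor ?L"
      then have x: "x \<in> (\<Pi>\<^sub>E i\<in>I. l i ` cat_mor C)" "\<And>i j. (i, j) \<in> r \<Longrightarrow> \<psi> i j (x j) = x i"
        by (auto simp: morL limit_topology_def X_def)
      \<comment> \<open>A common point of all \<open>K i\<close> is a preimage of \<open>x\<close>.
        These sets are closed, so compactness reduces its existence to finitely many indices; they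
        lie below a single \<open>k\<close>, and any morphism with label \<open>x k\<close> at
        \<open>k\<close> has the right label at each of them.\<close>
      define K where "K i = {f \<in> cat_mor C. l i f = x i}" for i
      have "closedin (mor_top C) (K i)" if i: "i \<in> I" for i
      proof -
        have "continuous_map (mor_top C) (discrete_topology (l i ` cat_mor C)) (\<lambda>f. \<beta> f i)"
          using cont\<beta> i
          by (simp add: morL limit_topology_def continuous_map_in_subtopology
              continuous_map_componentwise X_def)
        moreover have "closedin (discrete_topology (l i ` cat_mor C)) {x i}"
          using x(1) i by (auto simp: PiE_def Pi_def)
        ultimately have "closedin (mor_top C) {f \<in> cat_mor C. \<beta> f i \<in> {x i}}"
          by (rule closedin_continuous_map_preimage)
        then show ?thesis
          using i by (simp add: K_def \<beta>_def)
      qed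
      moreover have "\<Inter>\<F> \<noteq> {}" if \<F>: "finite \<F>" "\<F> \<subseteq> K ` I" for \<F>
      proof -
        obtain J where J: "J \<subseteq> I" "finite J" "\<F> = K ` J"
          using finite_subset_image[OF \<F>] by blast
        then obtain k where k: "k \<in> I" "\<forall>j\<in>J. (j, k) \<in> r"
          using lower by blast
        then obtain f where f: "f \<in> cat_mor C" "x k = l k f"
          using x(1) by (auto simp: PiE_def Pi_def)
        have "f \<in> K j" if "j \<in> J" for j
          using \<psi>[of j k f] x(2)[of j k] that k f by (simp add: K_def)
        then show ?thesis
          using J by blast
      qed
      ultimately have "\<Inter>(K ` I) \<noteq> {}"
        using compact unfolding compact_space_fip by (metis (mono_tags, lifting) imageE)
      then obtain f where f: "f \<in> K i" if "i \<in> I" for i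
        by blast
      moreover obtain i where "i \<in> I"
        using directed by (auto simp: directed_set_def)
      ultimately have "f \<in> cat_mor C"
        by (auto simp: K_def)
      moreover have "x = \<beta> f"
        using f x(1) by (auto simp: \<beta>_def K_def PiE_def extensional_def fun_eq_iff)
      ultimately show "x \<in> \<beta> ` cat_mor C"
        by blast
    qed
  qed
  have inj\<beta>: "inj_on \<beta> (cat_mor C)"
  proof (rule inj_onI, rule ccontr)
    fix f g assume fg: "f \<in> cat_mor C" "g \<in> cat_mor C" "\<beta> f = \<beta> g" "f \<noteq> g"
    then obtain E where E: "E \<in> I" "(f, g) \<notin> E"
      using sep by (auto simp: I_def)
    then have "l E f = l E g"
      using fun_cong[OF fg(3), of E] by (simp add: \<beta>_def)
    then show False
      using l[of E f g] E fg by (simp add: I_def)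
  qed
  have "top_category_iso C ?L \<alpha> \<beta>"
    unfolding top_category_iso_def
  proof (intro conjI)
    show "homeomorphic_map (ob_top C) (ob_top ?L) \<alpha>"
      using cont\<alpha> Haus(1) surj\<alpha> inj\<alpha> ob
      by (intro continuous_imp_homeomorphic_map) (auto simp: compact_space_discrete_topology)
    show "homeomorphic_map (mor_top C) (mor_top ?L) \<beta>"
      using cont\<beta> Haus(2) surj\<beta> inj\<beta> compact by (intro continuous_imp_homeomorphic_map)
    note simps = congruence_labelling.quotient_dom[OF lab] congruence_labelling.quotient_cod[OF lab]
      congruence_labelling.quotient_id[OF lab] congruence_labelling.quotient_comp[OF lab]
    show "continuous_functor C ?L \<alpha> \<beta>"
      unfolding continuous_functor_def
    proof (intro conjI ballI)
      fix f assume "f \<in> cat_mor C"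
      then show "cat_dom ?L (\<beta> f) = \<alpha> (cat_dom C f)" "cat_cod ?L (\<beta> f) = \<alpha> (cat_cod C f)"
        by (auto simp: cat_inverse_limit_def \<alpha>_def \<beta>_def X_def simps)
    next
      fix q assume "q \<in> cat_ob C"
      then show "\<beta> (cat_id C q) = cat_id ?L (\<alpha> q)"
        by (auto simp: cat_inverse_limit_def \<alpha>_def \<beta>_def X_def simps)
    next
      fix p assume "p \<in> composable_pairs C"
      then show "case p of (g, f) \<Rightarrow> \<beta> (cat_comp C g f) = cat_comp ?L (\<beta> g) (\<beta> f)"
        by (auto simp: cat_inverse_limit_def \<alpha>_def \<beta>_def X_def simps)
    qed (fact cont\<alpha> cont\<beta>)+
  qed
  then show ?thesis
    unfolding profinite_category_def using C system fin by blast
qed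

section \<open>The topological category of profinite semigroups\<close>

lemma topspace_pointwise_topology [simp]: "topspace (pointwise_topology S R) = sg_Hom S R"
  unfolding pointwise_topology_def sg_Hom_def continuous_sg_hom_def
  by (auto simp: PiE_def dest: continuous_map_funspace)

lemma cat_mor_Pro_category:
  "((S, R), f) \<in> cat_mor (Pro_category F) \<longleftrightarrow> S \<in> F \<and> R \<in> F \<and> f \<in> sg_Hom S R"
  by (auto simp: Pro_category_def)

lemma Pro_category_simps [simp]:
  "ob_top (Pro_category F) = discrete_topology F"
  "cat_dom (Pro_category F) ((S, R), f) = S"
  "cat_cod (Pro_category F) ((S, R), f) = R"
  "cat_comp (Pro_category F) ((S', R'), g) ((S, R), f) = ((S, R'), compose (sg_carrier S) g f)"
  "cat_id (Pro_category F) S = ((S, S), \<lambda>x\<in>sg_carrier S. x)"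
  by (simp_all add: Pro_category_def)

lemma sg_Hom_carrier: "f \<in> sg_Hom S R \<Longrightarrow> x \<in> sg_carrier S \<Longrightarrow> f x \<in> sg_carrier R"
  by (auto simp: sg_Hom_def continuous_sg_hom_def dest: continuous_map_funspace)

lemma sg_Hom_compose:
  assumes S: "topological_semigroup S" and f: "f \<in> sg_Hom S R" and g: "g \<in> sg_Hom R Q"
  shows "compose (sg_carrier S) g f \<in> sg_Hom S Q"
proof -
  have "continuous_map (sg_top S) (sg_top Q) (g \<circ> f)"
    using f g by (auto simp: sg_Hom_def continuous_sg_hom_def intro: continuous_map_compose)
  then have "continuous_map (sg_top S) (sg_top Q) (compose (sg_carrier S) g f)"
    by (rule continuous_map_eq) (simp add: compose_def)
  then show ?thesis
    using S f g sg_Hom_carrier[OF f]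
    by (auto simp: sg_Hom_def continuous_sg_hom_def topological_semigroup_def compose_def)
qed

lemma sg_Hom_id: "topological_semigroup S \<Longrightarrow> (\<lambda>x\<in>sg_carrier S. x) \<in> sg_Hom S S"
  by (auto simp: sg_Hom_def continuous_sg_hom_def topological_semigroup_def
      intro: continuous_map_eq[OF continuous_map_id])

lemma composable_pairs_Pro_category:
  "(q, p) \<in> composable_pairs (Pro_category F) \<longleftrightarrow>
     (\<exists>S R Q f g. p = ((S, R), f) \<and> q = ((R, Q), g) \<and> S \<in> F \<and> R \<in> F \<and> Q \<in> F \<and>
        f \<in> sg_Hom S R \<and> g \<in> sg_Hom R Q)"
  by (cases p; cases q) (auto simp: composable_pairs_def cat_mor_Pro_category)

lemma is_category_Pro_category:
  assumes "\<And>S. S \<in> F \<Longrightarrow> topological_semigroup S"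
  shows "is_category (Pro_category F)"
  unfolding is_category_def
proof (intro conjI)
  show "\<forall>f\<in>cat_mor (Pro_category F). cat_dom (Pro_category F) f \<in> cat_ob (Pro_category F) \<and>
      cat_cod (Pro_category F) f \<in> cat_ob (Pro_category F)"
    by (auto simp: cat_mor_Pro_category)
  show "\<forall>q\<in>cat_ob (Pro_category F). cat_id (Pro_category F) q \<in> cat_mor (Pro_category F) \<and>
        cat_dom (Pro_category F) (cat_id (Pro_category F) q) = q \<and>
        cat_cod (Pro_category F) (cat_id (Pro_category F) q) = q"
    using assms by (auto simp: cat_mor_Pro_category sg_Hom_id)
  show "\<forall>(g, f)\<in>composable_pairs (Pro_category F).
      cat_comp (Pro_category F) g f \<in> cat_mor (Pro_category F) \<and>
      cat_dom (Pro_category F) (cat_comp (Pro_category F) g f) = cat_dom (Pro_category F) f \<and>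
      cat_cod (Pro_category F) (cat_comp (Pro_category F) g f) = cat_cod (Pro_category F) g"
    by (auto simp: composable_pairs_Pro_category cat_mor_Pro_category
        intro: sg_Hom_compose[OF assms])
  show "\<forall>f\<in>cat_mor (Pro_category F).
      cat_comp (Pro_category F) f (cat_id (Pro_category F) (cat_dom (Pro_category F) f)) = f \<and>
      cat_comp (Pro_category F) (cat_id (Pro_category F) (cat_cod (Pro_category F) f)) f = f"
  proof (clarify)
    fix S R f assume "((S, R), f) \<in> cat_mor (Pro_category F)"
    then have f: "f \<in> sg_Hom S R"
      by (simp add: cat_mor_Pro_category)
    \<comment> \<open>\<open>compose\<close> discards values off the carrier, so the identity laws
      depend on extensionality.\<close>
    then have "f \<in> extensional (sg_carrier S)"
      by (simp add: sg_Hom_def)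
    then have "compose (sg_carrier S) f (\<lambda>x\<in>sg_carrier S. x) = f"
      "compose (sg_carrier S) (\<lambda>x\<in>sg_carrier R. x) f = f"
      using sg_Hom_carrier[OF f] by (auto simp: compose_def extensional_def fun_eq_iff)
    then show "cat_comp (Pro_category F) ((S, R), f)
          (cat_id (Pro_category F) (cat_dom (Pro_category F) ((S, R), f))) = ((S, R), f) \<and>
        cat_comp (Pro_category F) (cat_id (Pro_category F) (cat_cod (Pro_category F) ((S, R), f)))
          ((S, R), f) = ((S, R), f)"
      by simp
  qed
  show "\<forall>h g f. (h, g) \<in> composable_pairs (Pro_category F) \<longrightarrow>
      (g, f) \<in> composable_pairs (Pro_category F) \<longrightarrow>
      cat_comp (Pro_category F) (cat_comp (Pro_category F) h g) f =
      cat_comp (Pro_category F) h (cat_comp (Pro_category F) g f)"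
    by (auto simp: composable_pairs_Pro_category compose_def fun_eq_iff sg_Hom_carrier)
qed

section \<open>Open sets of morphisms and joint continuity of composition\<close>

lemma openin_Pro_category_component:
  assumes "S \<in> F" "R \<in> F" "openin (pointwise_topology S R) U"
  shows "openin (mor_top (Pro_category F)) (Pair (S, R) ` U)"
proof -
  have "{x. (p, x) \<in> Pair (S, R) ` U} = (if p = (S, R) then U else {})" for p
    by auto
  moreover have "U \<subseteq> sg_Hom S R"
    using openin_subset[OF assms(3)] by simp
  ultimately show ?thesis
    using assms by (auto simp: Pro_category_def openin_sum_topology)
qed

text \<open>For a homomorphism \<open>f\<close> and finite \<open>P\<close> and \<open>D\<close>
  this is a neighbourhood given by finitely many tests at finitely many points. It lies in one
  summand and so also fixes source and target; with \<open>P\<close> and \<open>D\<close> empty it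
  is the whole Hom set.\<close>

definition agreeing :: "'a top_semigroup \<Rightarrow> 'a top_semigroup \<Rightarrow> ('a \<Rightarrow> 'a) \<Rightarrow> ('a \<Rightarrow> nat) set \<Rightarrow> 'a set \<Rightarrow>
    (('a top_semigroup \<times> 'a top_semigroup) \<times> ('a \<Rightarrow> 'a)) set" where
  "agreeing S R f P D = Pair (S, R) ` {g \<in> sg_Hom S R. \<forall>c\<in>P. \<forall>x\<in>D. c (g x) = c (f x)}"

lemma openin_agreeing:
  assumes F: "S \<in> F" "R \<in> F"
    and P: "finite P" "P \<subseteq> finite_quotients n R" and D: "finite D" "D \<subseteq> sg_carrier S"
  shows "openin (mor_top (Pro_category F)) (agreeing S R f P D)"
proof -
  have "openin (pointwise_topology S R) {g \<in> sg_Hom S R. c (g x) = c (f x)}"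
    if "c \<in> P" "x \<in> D" for c x
  proof -
    have "continuous_map (pointwise_topology S R) (sg_top R) (\<lambda>g. g x)"
      using that D unfolding pointwise_topology_def
      by (intro continuous_map_from_subtopology continuous_map_product_projection) blast
    moreover have "continuous_map (sg_top R) (discrete_topology {..<n}) c"
      using P that by (auto simp: finite_quotients_def)
    ultimately have "continuous_map (pointwise_topology S R) (discrete_topology {..<n}) (\<lambda>g. c (g x))"
      using continuous_map_compose unfolding comp_def by blast
    from openin_discrete_fibre[OF this] show ?thesis
      by simp
  qed
  then have "openin (pointwise_topology S R)
      (topspace (pointwise_topology S R) \<inter>
        \<Inter> ((\<lambda>(c, x). {g \<in> sg_Hom S R. c (g x) = c (f x)}) ` (P \<times> D)))"
    using P D openin_topspace[of "pointwise_topology S R"] by (intro openin_Int_Inter) auto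
  moreover have "topspace (pointwise_topology S R) \<inter>
        \<Inter> ((\<lambda>(c, x). {g \<in> sg_Hom S R. c (g x) = c (f x)}) ` (P \<times> D)) =
      {g \<in> sg_Hom S R. \<forall>c\<in>P. \<forall>x\<in>D. c (g x) = c (f x)}"
    by auto
  ultimately show ?thesis
    unfolding agreeing_def using F by (simp add: openin_Pro_category_component)
qed

text \<open>Where the endpoints are constant, \<open>k\<close> factors through a single summand. The
  topology there is induced by the evaluations, whose continuity is detected by tests. The local
  pieces are then pasted.\<close>

lemma continuous_map_into_Pro_category:
  assumes F: "\<And>S. S \<in> F \<Longrightarrow> profinite_semigroup S"
    and k: "\<And>y. y \<in> topspace Y \<Longrightarrow> k y \<in> cat_mor (Pro_category F)"
    and loc: "\<And>y S R f. y \<in> topspace Y \<Longrightarrow> k y = ((S, R), f) \<Longrightarrow>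
      \<exists>U. openin Y U \<and> y \<in> U \<and> (\<forall>z\<in>U. fst (k z) = (S, R))"
    and agree: "\<And>y S R f x n c. y \<in> topspace Y \<Longrightarrow> k y = ((S, R), f) \<Longrightarrow> x \<in> sg_carrier S \<Longrightarrow>
      c \<in> finite_quotients n R \<Longrightarrow>
      \<exists>U. openin Y U \<and> y \<in> U \<and> (\<forall>z\<in>U. c (snd (k z) x) = c (f x))"
  shows "continuous_map Y (mor_top (Pro_category F)) k"
proof -
  have "\<exists>U. openin Y U \<and> y \<in> U \<and>
      continuous_map (subtopology Y U) (mor_top (Pro_category F)) k" if y: "y \<in> topspace Y" for y
  proof -
    obtain S R f where ky: "k y = ((S, R), f)"
      by (metis prod.exhaust)
    then have SR: "S \<in> F" "R \<in> F"
      using k[OF y] by (auto simp: cat_mor_Pro_category)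
    obtain U where U: "openin Y U" "y \<in> U" and fst: "\<And>z. z \<in> U \<Longrightarrow> fst (k z) = (S, R)"
      using loc[OF y ky] by blast
    have UY: "U \<subseteq> topspace Y"
      using U by (simp add: openin_subset)
    have kz: "k z = ((S, R), snd (k z))" if "z \<in> U" for z
      using fst[OF that] by (metis prod.collapse)
    have Hom: "snd (k z) \<in> sg_Hom S R" if "z \<in> U" for z
      using k[of z] kz[OF that] UY that by (metis cat_mor_Pro_category subsetD)
    have "continuous_map (subtopology Y U) (sg_top R) (\<lambda>z. snd (k z) x)" if x: "x \<in> sg_carrier S" for x
    proof (rule continuous_map_into_profinite_semigroup[OF F[OF SR(2)]])
      show "snd (k z) x \<in> sg_carrier R" if "z \<in> topspace (subtopology Y U)" for z
        using sg_Hom_carrier[OF Hom x] that by simp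
      fix n c assume c: "c \<in> finite_quotients n R"
      show "continuous_map (subtopology Y U) (discrete_topology {..<n}) (\<lambda>z. c (snd (k z) x))"
      proof (rule continuous_map_discrete_topologyI)
        fix z assume "z \<in> topspace (subtopology Y U)"
        then have z: "z \<in> U" "z \<in> topspace Y"
          by auto
        have "c \<in> sg_carrier R \<rightarrow> {..<n}"
          using c continuous_map_funspace by (fastforce simp: finite_quotients_def)
        then show "c (snd (k z) x) \<in> {..<n}"
          using sg_Hom_carrier[OF Hom[OF z(1)] x] by blast
        obtain W where W: "openin Y W" "z \<in> W" "\<forall>w\<in>W. c (snd (k w) x) = c (snd (k z) x)"
          using agree[OF z(2) kz[OF z(1)] x c] by blast
        then show "\<exists>W. openin (subtopology Y U) W \<and> z \<in> W \<and> (\<forall>w\<in>W. c (snd (k w) x) = c (snd (k z) x))"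
          using z openin_subtopology_Int2[OF W(1), of U] by blast
      qed
    qed
    then have "continuous_map (subtopology Y U) (pointwise_topology S R) (\<lambda>z. snd (k z))"
      unfolding pointwise_topology_def continuous_map_in_subtopology continuous_map_componentwise
      using Hom by (auto simp: sg_Hom_def)
    moreover have "continuous_map (pointwise_topology S R) (mor_top (Pro_category F)) (Pair (S, R))"
      using continuous_map_component_injection[of "(S, R)" "F \<times> F" "\<lambda>(S, R). pointwise_topology S R"] SR
      by (simp add: Pro_category_def)
    ultimately have "continuous_map (subtopology Y U) (mor_top (Pro_category F)) (Pair (S, R) \<circ> (\<lambda>z. snd (k z)))"
      by (rule continuous_map_compose)
    then have "continuous_map (subtopology Y U) (mor_top (Pro_category F)) k"
      by (rule continuous_map_eq) (simp add: kz[symmetric])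
    then show ?thesis
      using U by blast
  qed
  then obtain U where U: "\<And>y. y \<in> topspace Y \<Longrightarrow> openin Y (U y) \<and> y \<in> U y \<and>
      continuous_map (subtopology Y (U y)) (mor_top (Pro_category F)) k"
    by metis
  show ?thesis
    by (rule pasting_lemma[where I = "topspace Y" and T = U and f = "\<lambda>_. k"]) (use U in auto)
qed

lemma continuous_compose_Pro_category:
  assumes profinite: "\<And>S. S \<in> F \<Longrightarrow> profinite_semigroup S"
    and fg: "\<And>S. S \<in> F \<Longrightarrow> finitely_generated S"
  shows "continuous_map
    (subtopology (prod_topology (mor_top (Pro_category F)) (mor_top (Pro_category F)))
      (composable_pairs (Pro_category F)))
    (mor_top (Pro_category F)) (\<lambda>(g, f). cat_comp (Pro_category F) g f)"
    (is "continuous_map ?Y _ ?k")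
proof (rule continuous_map_into_Pro_category[OF profinite])
  have sg: "topological_semigroup S" if "S \<in> F" for S
    using profinite[OF that] by (simp add: profinite_semigroup_def)
  have Y: "topspace ?Y = composable_pairs (Pro_category F)"
    by (auto simp: composable_pairs_def)
  show "?k y \<in> cat_mor (Pro_category F)" if "y \<in> topspace ?Y" for y
    using that unfolding Y
    by (cases y) (auto simp: composable_pairs_Pro_category cat_mor_Pro_category
        intro: sg_Hom_compose[OF sg])
  fix y S Q h assume y: "y \<in> topspace ?Y" and ky: "?k y = ((S, Q), h)"
  obtain R f g where y_eq: "y = (((R, Q), g), ((S, R), f))" and F: "S \<in> F" "R \<in> F" "Q \<in> F"
    and f: "f \<in> sg_Hom S R" and g: "g \<in> sg_Hom R Q" and h: "h = compose (sg_carrier S) g f"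
    using y ky unfolding Y by (cases y) (auto simp: composable_pairs_Pro_category)
  let ?B = "\<lambda>P D P' D'. composable_pairs (Pro_category F) \<inter> agreeing R Q g P D \<times> agreeing S R f P' D'"
  have B: "openin ?Y (?B P D P' D') \<and> y \<in> ?B P D P' D'"
    if "finite P" "P \<subseteq> finite_quotients n Q" "finite D" "D \<subseteq> sg_carrier R"
      "finite P'" "P' \<subseteq> finite_quotients n R" "finite D'" "D' \<subseteq> sg_carrier S" for n P D P' D'
    using that F f g y unfolding Y
    by (auto simp: agreeing_def y_eq openin_prod_Times_iff
        intro!: openin_subtopology_Int2 openin_agreeing[unfolded agreeing_def])
  have k: "?k z = ((S, Q), compose (sg_carrier S) (snd (fst z)) (snd (snd z)))"
    if "z \<in> ?B P D P' D'" for P D P' D' z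
    using that by (auto simp: agreeing_def)
  \<comment> \<open>Without tests the neighbourhood is a full product of two Hom sets, which fixes
    the endpoints of the composite.\<close>
  show "\<exists>U. openin ?Y U \<and> y \<in> U \<and> (\<forall>z\<in>U. fst (?k z) = (S, Q))"
    using B[of "{}" 0 "{}" "{}" "{}"] k by (intro exI[of _ "?B {} {} {} {}"]) auto
  fix x n c assume x: "x \<in> sg_carrier S" and c: "c \<in> finite_quotients n Q"
  have fin: "finite (finite_quotients n R)"
    using finite_finite_quotients[OF sg fg] F by blast
  \<comment> \<open>The aim is \<open>c (g' (f' x)) = c (g' (f x)) = c (g (f x))\<close>. The second
    equality is one test at the point \<open>f x\<close>; the first uses all tests of size
    \<open>n\<close> on \<open>R\<close>, since \<open>g'\<close> varies. Finite generation of the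
    middle object \<open>R\<close> makes \<open>?U\<close> open.\<close>
  let ?U = "?B {c} {f x} (finite_quotients n R) {x}"
  have "c (snd (?k z) x) = c (h x)" if z: "z \<in> ?U" for z
  proof -
    obtain g' f' where z_eq: "z = (((R, Q), g'), ((S, R), f'))"
      and f': "f' \<in> sg_Hom S R" "\<forall>c\<in>finite_quotients n R. c (f' x) = c (f x)"
      and g': "g' \<in> sg_Hom R Q" "c (g' (f x)) = c (g (f x))"
      using z by (auto simp: agreeing_def)
    \<comment> \<open>Uniformity in \<open>g'\<close>: every \<open>c \<circ> g'\<close> is one of the finitely many quotients of \<open>R\<close>.\<close>
    have "compose (sg_carrier R) c g' \<in> finite_quotients n R"
      using g'(1) F sg c by (intro finite_quotients_compose) (auto simp: sg_Hom_def)
    then have "compose (sg_carrier R) c g' (f' x) = compose (sg_carrier R) c g' (f x)"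
      using f'(2) by blast
    then have "c (g' (f' x)) = c (g' (f x))"
      using sg_Hom_carrier[OF f x] sg_Hom_carrier[OF f'(1) x] by (simp add: compose_def)
    then show ?thesis
      using g'(2) x by (simp add: z_eq h compose_def)
  qed
  moreover have "openin ?Y ?U \<and> y \<in> ?U"
    using c x fin sg_Hom_carrier[OF f x] by (intro B) auto
  ultimately show "\<exists>U. openin ?Y U \<and> y \<in> U \<and> (\<forall>z\<in>U. c (snd (?k z) x) = c (h x))"
    by blast
qed

lemma topological_category_Pro_category:
  assumes profinite: "\<And>S. S \<in> F \<Longrightarrow> profinite_semigroup S"
    and fg: "\<And>S. S \<in> F \<Longrightarrow> finitely_generated S"
  shows "topological_category (Pro_category F)"
  unfolding topological_category_def
proof (intro conjI)
  show cat: "is_category (Pro_category F)"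
    using profinite by (intro is_category_Pro_category) (simp add: profinite_semigroup_def)
  have "continuous_map (mor_top (Pro_category F)) (discrete_topology (F \<times> F)) fst"
  proof (rule continuous_map_discrete_topologyI)
    fix p assume p: "p \<in> cat_mor (Pro_category F)"
    obtain S R f where p_eq: "p = ((S, R), f)"
      by (metis prod.exhaust)
    then have *: "S \<in> F" "R \<in> F" "f \<in> sg_Hom S R"
      using p by (simp_all add: cat_mor_Pro_category)
    then show "fst p \<in> F \<times> F"
      by (simp add: p_eq)
    show "\<exists>U. openin (mor_top (Pro_category F)) U \<and> p \<in> U \<and> (\<forall>q\<in>U. fst q = fst p)"
      using * openin_agreeing[of S F R "{}" 0 "{}"]
      by (intro exI[of _ "agreeing S R f {} {}"]) (auto simp: p_eq agreeing_def)
  qed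
  then have "continuous_map (mor_top (Pro_category F)) (discrete_topology F) (fst \<circ> fst)"
    "continuous_map (mor_top (Pro_category F)) (discrete_topology F) (snd \<circ> fst)"
    by (auto intro!: continuous_map_compose)
  moreover have "cat_dom (Pro_category F) = fst \<circ> fst" "cat_cod (Pro_category F) = snd \<circ> fst"
    by (auto simp: Pro_category_def fun_eq_iff)
  ultimately show
    "continuous_map (mor_top (Pro_category F)) (ob_top (Pro_category F)) (cat_dom (Pro_category F))"
    "continuous_map (mor_top (Pro_category F)) (ob_top (Pro_category F)) (cat_cod (Pro_category F))"
    by simp_all
  show "continuous_map (ob_top (Pro_category F)) (mor_top (Pro_category F)) (cat_id (Pro_category F))"
    using cat by (auto simp: is_category_def)
qed (rule continuous_compose_Pro_category[OF assms])

lemma openin_finite_quotients_class: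
  assumes "finite (finite_quotients n S)"
  shows "openin (sg_top S) {y \<in> sg_carrier S. \<forall>d\<in>finite_quotients n S. d y = d x}"
proof -
  have "openin (sg_top S)
      (sg_carrier S \<inter> \<Inter> ((\<lambda>d. {y \<in> sg_carrier S. d y = d x}) ` finite_quotients n S))"
    using assms
    by (intro openin_Int_Inter) (auto simp: finite_quotients_def intro: openin_discrete_fibre)
  moreover have "sg_carrier S \<inter> \<Inter> ((\<lambda>d. {y \<in> sg_carrier S. d y = d x}) ` finite_quotients n S) =
      {y \<in> sg_carrier S. \<forall>d\<in>finite_quotients n S. d y = d x}"
    by auto
  ultimately show ?thesis
    by simp
qed

text \<open>The composite of \<open>c\<close> with \<open>f\<close> is itself a test of size
  \<open>n\<close> on \<open>S\<close>. In this form equicontinuity serves both the closedness of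
  Hom sets and the level congruences.\<close>

lemma finite_quotients_eq_on_Hom:
  assumes S: "topological_semigroup S" and f: "f \<in> sg_Hom S R" and c: "c \<in> finite_quotients n R"
    and xy: "x \<in> sg_carrier S" "y \<in> sg_carrier S" and eq: "\<And>d. d \<in> finite_quotients n S \<Longrightarrow> d x = d y"
  shows "c (f x) = c (f y)"
proof -
  have "compose (sg_carrier S) c f \<in> finite_quotients n S"
    using f by (intro finite_quotients_compose[OF S _ c]) (simp add: sg_Hom_def)
  from eq[OF this] show ?thesis
    using xy by (simp add: compose_def)
qed

section \<open>Compactness and level congruences\<close>

text \<open>Multiplicativity is an equation between continuous maps from the product to a Hausdorff
  space, and extensionality is built into the product, so both pass to the closure. The obstacle is
  continuity, which pointwise limits of continuous maps usually lose.\<close>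

lemma closedin_sg_Hom:
  assumes S: "topological_semigroup S" "finitely_generated S" and R: "profinite_semigroup R"
  shows "closedin (product_topology (\<lambda>_. sg_top R) (sg_carrier S)) (sg_Hom S R)"
    (is "closedin ?P _")
proof -
  have "f \<in> sg_Hom S R" if f: "f \<in> ?P closure_of sg_Hom S R" for f
  proof -
    have fP: "f \<in> topspace ?P"
      using f in_closure_of by fast
    then have fR: "f x \<in> sg_carrier R" if "x \<in> sg_carrier S" for x
      using that by auto
    have proj: "continuous_map ?P (sg_top R) (\<lambda>g. g x)" if "x \<in> sg_carrier S" for x
      using that by (rule continuous_map_product_projection)
    have "f (sg_mult S x y) = sg_mult R (f x) (f y)"
      if x: "x \<in> sg_carrier S" and y: "y \<in> sg_carrier S" for x y
    proof (rule forall_in_closure_of_eq[OF f profinite_semigroup_Hausdorff[OF R],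
          where f = "\<lambda>g. g (sg_mult S x y)" and g = "\<lambda>g. sg_mult R (g x) (g y)"])
      show "continuous_map ?P (sg_top R) (\<lambda>g. g (sg_mult S x y))"
        using S x y by (intro proj) (simp add: topological_semigroup_def)
      have "continuous_map ?P (prod_topology (sg_top R) (sg_top R)) (\<lambda>g. (g x, g y))"
        using x y by (simp add: continuous_map_pairwise comp_def proj)
      moreover have "continuous_map (prod_topology (sg_top R) (sg_top R)) (sg_top R) (\<lambda>(x, y). sg_mult R x y)"
        using R by (simp add: profinite_semigroup_def topological_semigroup_def)
      ultimately have "continuous_map ?P (sg_top R) ((\<lambda>(x, y). sg_mult R x y) \<circ> (\<lambda>g. (g x, g y)))"
        by (rule continuous_map_compose)
      then show "continuous_map ?P (sg_top R) (\<lambda>g. sg_mult R (g x) (g y))"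
        by (simp add: comp_def)
      show "g (sg_mult S x y) = sg_mult R (g x) (g y)" if "g \<in> sg_Hom S R" for g
        using that x y by (simp add: sg_Hom_def continuous_sg_hom_def)
    qed
    \<comment> \<open>A pointwise limit is continuous because all homomorphisms respect the same open partition
      of \<open>S\<close>.\<close>
    moreover have "continuous_map (sg_top S) (sg_top R) f"
    proof (rule continuous_map_into_profinite_semigroup[OF R fR])
      fix n c assume c: "c \<in> finite_quotients n R"
      then have cont: "continuous_map (sg_top R) (discrete_topology {..<n}) c"
        by (simp add: finite_quotients_def)
      show "continuous_map (sg_top S) (discrete_topology {..<n}) (\<lambda>x. c (f x))"
      proof (rule continuous_map_discrete_topologyI)
        fix x assume x: "x \<in> sg_carrier S"
        show "c (f x) \<in> {..<n}"
          using continuous_map_funspace[OF cont] fR[OF x] by auto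
        have "c (f y) = c (f x)"
          if y: "y \<in> sg_carrier S" and xy: "\<forall>d\<in>finite_quotients n S. d y = d x" for y
        proof -
          have "openin ?P {g \<in> topspace ?P. c (g z) = c (f z)}" if "z \<in> sg_carrier S" for z
            using openin_discrete_fibre[OF continuous_map_compose[OF proj[OF that] cont]]
            by (simp add: comp_def)
          \<comment> \<open>One homomorphism \<open>g\<close> that \<open>c\<close> cannot tell from
            \<open>f\<close> at \<open>x\<close> and at \<open>y\<close> is enough: it transfers
            \<open>c (g x) = c (g y)\<close> to \<open>f\<close>.\<close>
          then have "openin ?P ({g \<in> topspace ?P. c (g x) = c (f x)} \<inter> {g \<in> topspace ?P. c (g y) = c (f y)})"
            using x y by (intro openin_Int)
          moreover have "f \<in> {g \<in> topspace ?P. c (g x) = c (f x)} \<inter> {g \<in> topspace ?P. c (g y) = c (f y)}"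
            using fP by simp
          ultimately have "\<exists>g. g \<in> sg_Hom S R \<and>
              g \<in> {g \<in> topspace ?P. c (g x) = c (f x)} \<inter> {g \<in> topspace ?P. c (g y) = c (f y)}"
            using in_closure_of[THEN iffD1, OF f, THEN conjunct2, rule_format] by meson
          then obtain g where g: "g \<in> sg_Hom S R" "c (g x) = c (f x)" "c (g y) = c (f y)"
            by blast
          then show ?thesis
            using finite_quotients_eq_on_Hom[OF S(1) g(1) c x y] xy by metis
        qed
        then show "\<exists>U. openin (sg_top S) U \<and> x \<in> U \<and> (\<forall>y\<in>U. c (f y) = c (f x))"
          using openin_finite_quotients_class[OF finite_finite_quotients[OF S, of n], of x] x
          by (intro exI[of _ "{y \<in> sg_carrier S. \<forall>d\<in>finite_quotients n S. d y = d x}"]) blast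
      qed
    qed
    ultimately show ?thesis
      using fP by (simp add: sg_Hom_def continuous_sg_hom_def PiE_def)
  qed
  moreover have "sg_Hom S R \<subseteq> topspace ?P"
    using sg_Hom_carrier by (fastforce simp: PiE_def sg_Hom_def)
  ultimately show ?thesis
    using closure_of_subset_eq by blast
qed

lemma compact_pointwise_topology:
  assumes "topological_semigroup S" "finitely_generated S" "profinite_semigroup R"
  shows "compact_space (pointwise_topology S R)"
proof -
  have "compact_space (product_topology (\<lambda>_. sg_top R) (sg_carrier S))"
    using profinite_semigroup_compact[OF assms(3)] by (simp add: compact_space_product_topology)
  then show ?thesis
    unfolding pointwise_topology_def
    using closedin_sg_Hom[OF assms] by (intro compact_space_subtopology closedin_compact_space)
qed

text \<open>One \<open>n\<close> serves all Hom sets at once, because pulling a test back along a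
  morphism preserves its size; this makes the relation compatible with composition across different
  objects.\<close>

definition level_congruence :: "nat \<Rightarrow> 'a top_semigroup set \<Rightarrow>
    ((('a top_semigroup \<times> 'a top_semigroup) \<times> ('a \<Rightarrow> 'a)) \<times>
     (('a top_semigroup \<times> 'a top_semigroup) \<times> ('a \<Rightarrow> 'a))) set" where
  "level_congruence n F =
     {(((S, R), f), ((S', R'), g)). S' = S \<and> R' = R \<and> S \<in> F \<and> R \<in> F \<and>
        f \<in> sg_Hom S R \<and> g \<in> sg_Hom S R \<and>
        (\<forall>c\<in>finite_quotients n R. \<forall>x\<in>sg_carrier S. c (f x) = c (g x))}"

text \<open>Finitely many tests with finitely many values produce finitely many value vectors
  \<open>G x\<close>, and one point is kept for each. The finite set \<open>D\<close> allows a
  condition at all points of \<open>S\<close> to be controlled by pointwise convergence.\<close>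

lemma finite_quotients_representatives:
  assumes "finite (finite_quotients n S)"
  obtains D where "finite D" "D \<subseteq> sg_carrier S"
    "\<And>x. x \<in> sg_carrier S \<Longrightarrow> \<exists>d\<in>D. \<forall>c\<in>finite_quotients n S. c x = c d"
proof -
  define G where "G x = (\<lambda>c\<in>finite_quotients n S. c x)" for x
  have "G ` sg_carrier S \<subseteq> finite_quotients n S \<rightarrow>\<^sub>E {..<n}"
    unfolding G_def
  proof (intro image_subsetI restrict_PiE_iff[THEN iffD2] ballI)
    fix x c assume "x \<in> sg_carrier S" "c \<in> finite_quotients n S"
    then show "c x \<in> {..<n}"
      using continuous_map_funspace[of "sg_top S" "discrete_topology {..<n}" c]
      by (auto simp: finite_quotients_def)
  qed
  moreover have "finite (finite_quotients n S \<rightarrow>\<^sub>E {..<n})"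
    using assms by (intro finite_PiE) auto
  ultimately have "finite (G ` sg_carrier S)"
    by (rule finite_subset)
  from finite_subset_image[OF this subset_refl]
  obtain D where D: "D \<subseteq> sg_carrier S" "finite D" "G ` sg_carrier S = G ` D"
    by auto
  have "\<exists>d\<in>D. \<forall>c\<in>finite_quotients n S. c x = c d" if "x \<in> sg_carrier S" for x
  proof -
    have "G x \<in> G ` D"
      using imageI[OF that, of G] by (simp only: D(3))
    then obtain d where "d \<in> D" "G x = G d"
      by (rule imageE)
    then show ?thesis
      unfolding G_def by (metis restrict_apply')
  qed
  with D show thesis
    using that by blast
qed

lemma open_congruence_level_congruence:
  assumes profinite: "\<And>S. S \<in> F \<Longrightarrow> profinite_semigroup S"
    and fg: "\<And>S. S \<in> F \<Longrightarrow> finitely_generated S"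
  shows "open_congruence (Pro_category F) (level_congruence n F)"
  unfolding open_congruence_def
proof (intro conjI)
  have sg: "topological_semigroup S" if "S \<in> F" for S
    using profinite[OF that] by (simp add: profinite_semigroup_def)
  have fin: "finite (finite_quotients n S)" if "S \<in> F" for S
    using finite_finite_quotients[OF sg fg] that by blast
  show "equiv (cat_mor (Pro_category F)) (level_congruence n F)"
    by (auto simp: equiv_def refl_on_def sym_def trans_def level_congruence_def cat_mor_Pro_category)
  show "\<forall>(f, g)\<in>level_congruence n F. cat_dom (Pro_category F) f = cat_dom (Pro_category F) g \<and>
      cat_cod (Pro_category F) f = cat_cod (Pro_category F) g"
    by (auto simp: level_congruence_def)
  show "\<forall>g f g' f'. (g, f) \<in> composable_pairs (Pro_category F) \<longrightarrow>
      (g, g') \<in> level_congruence n F \<longrightarrow> (f, f') \<in> level_congruence n F \<longrightarrow>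
      (cat_comp (Pro_category F) g f, cat_comp (Pro_category F) g' f') \<in> level_congruence n F"
  proof (intro allI impI)
    fix q p q' p'
    assume "(q, p) \<in> composable_pairs (Pro_category F)" "(q, q') \<in> level_congruence n F"
      "(p, p') \<in> level_congruence n F"
    then obtain S R Q f f' g g' where
      eqs: "p = ((S, R), f)" "p' = ((S, R), f')" "q = ((R, Q), g)" "q' = ((R, Q), g')"
      and F: "S \<in> F" "R \<in> F" "Q \<in> F"
      and f: "f \<in> sg_Hom S R" "f' \<in> sg_Hom S R" and g: "g \<in> sg_Hom R Q" "g' \<in> sg_Hom R Q"
      and ff': "\<And>c x. c \<in> finite_quotients n R \<Longrightarrow> x \<in> sg_carrier S \<Longrightarrow> c (f x) = c (f' x)"
      and gg': "\<And>c x. c \<in> finite_quotients n Q \<Longrightarrow> x \<in> sg_carrier R \<Longrightarrow> c (g x) = c (g' x)"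
      by (auto simp: level_congruence_def composable_pairs_Pro_category)
    have "c (g (f x)) = c (g' (f' x))" if c: "c \<in> finite_quotients n Q" and x: "x \<in> sg_carrier S" for c x
    proof -
      \<comment> \<open>The outer morphism is exchanged at the fixed point \<open>f x\<close>; after
        that \<open>g'\<close> preserves the indistinguishability of \<open>f x\<close> and
        \<open>f' x\<close>.\<close>
      have "c (g (f x)) = c (g' (f x))"
        using gg'[OF c sg_Hom_carrier[OF f(1) x]] .
      also have "\<dots> = c (g' (f' x))"
        using finite_quotients_eq_on_Hom[OF sg[OF F(2)] g(2) c
            sg_Hom_carrier[OF f(1) x] sg_Hom_carrier[OF f(2) x]] ff' x by blast
      finally show ?thesis .
    qed
    then show "(cat_comp (Pro_category F) q p, cat_comp (Pro_category F) q' p') \<in> level_congruence n F"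
      using F f g sg_Hom_compose[OF sg[OF F(1)]]
      by (auto simp: eqs level_congruence_def compose_eq)
  qed
  show "\<forall>p\<in>cat_mor (Pro_category F). openin (mor_top (Pro_category F)) (level_congruence n F `` {p})"
  proof
    fix p assume p: "p \<in> cat_mor (Pro_category F)"
    obtain S R f where "p = ((S, R), f)"
      by (metis prod.exhaust)
    with p have p_eq: "p = ((S, R), f)" and F: "S \<in> F" "R \<in> F" and f: "f \<in> sg_Hom S R"
      by (auto simp: cat_mor_Pro_category)
    obtain D where D: "finite D" "D \<subseteq> sg_carrier S"
      "\<And>x. x \<in> sg_carrier S \<Longrightarrow> \<exists>d\<in>D. \<forall>c\<in>finite_quotients n S. c x = c d"
      using finite_quotients_representatives[OF fin[OF F(1)]] by blast
    \<comment> \<open>Agreement on \<open>D\<close> spreads to all of \<open>S\<close>: neither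
      \<open>c (f x)\<close> nor \<open>c (g x)\<close> changes when \<open>x\<close> is replaced by
      its representative \<open>d\<close>.\<close>
    have "c (f x) = c (g x)"
      if g: "g \<in> sg_Hom S R" "\<forall>c\<in>finite_quotients n R. \<forall>x\<in>D. c (g x) = c (f x)"
        and c: "c \<in> finite_quotients n R" and x: "x \<in> sg_carrier S" for g c x
    proof -
      obtain d where d: "d \<in> D" "\<forall>c\<in>finite_quotients n S. c x = c d"
        using D(3)[OF x] by blast
      then have dS: "d \<in> sg_carrier S"
        using D(2) by blast
      have "c (f x) = c (f d)" "c (g x) = c (g d)"
        using finite_quotients_eq_on_Hom[OF sg[OF F(1)] _ c x dS] f g(1) d(2) by blast+
      then show ?thesis
        using g(2) c d(1) by metis
    qed
    then have "level_congruence n F `` {p} = agreeing S R f (finite_quotients n R) D"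
      using F f D(2) by (fastforce simp: p_eq level_congruence_def agreeing_def)
    then show "openin (mor_top (Pro_category F)) (level_congruence n F `` {p})"
      using openin_agreeing[OF F fin[OF F(2)] subset_refl D(1,2)] by simp
  qed
qed

text \<open>Morphisms related at even one level are parallel, so only maps with common endpoints
  remain to be separated. They differ at some point of \<open>S\<close>, where a test on
  \<open>R\<close> of some size tells the values apart.\<close>

lemma level_congruences_separate:
  assumes profinite: "\<And>S. S \<in> F \<Longrightarrow> profinite_semigroup S"
    and p: "p \<in> cat_mor (Pro_category F)" and q: "q \<in> cat_mor (Pro_category F)" and "p \<noteq> q"
  shows "\<exists>n. (p, q) \<notin> level_congruence n F"
proof (rule ccontr)
  assume "\<not> ?thesis"
  then have all: "(p, q) \<in> level_congruence n F" for n
    by blast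
  obtain S R f g where eqs: "p = ((S, R), f)" "q = ((S, R), g)"
    using all[of 0] by (auto simp: level_congruence_def)
  have F: "R \<in> F" and f: "f \<in> sg_Hom S R" and g: "g \<in> sg_Hom S R"
    using p q by (auto simp: eqs cat_mor_Pro_category)
  then have "f \<in> extensional (sg_carrier S)" "g \<in> extensional (sg_carrier S)"
    by (auto simp: sg_Hom_def)
  moreover have "f \<noteq> g"
    using \<open>p \<noteq> q\<close> by (simp add: eqs)
  ultimately obtain x where x: "x \<in> sg_carrier S" "f x \<noteq> g x"
    by (meson extensionalityI)
  obtain n c where "c \<in> finite_quotients n R" "c (f x) \<noteq> c (g x)"
    using finite_quotients_separate[OF profinite[OF F] sg_Hom_carrier[OF f x(1)]
        sg_Hom_carrier[OF g x(1)] x(2)] .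
  then show False
    using all[of n] x(1) by (auto simp: eqs level_congruence_def)
qed

theorem proposition4p1:
  fixes F :: "'a top_semigroup set"
  assumes "\<And>S. S \<in> F \<Longrightarrow> profinite_semigroup S"
    and "\<And>S. S \<in> F \<Longrightarrow> finitely_generated S"
  shows "topological_category (Pro_category F) \<and>
         (finite F \<longrightarrow> profinite_category (Pro_category F))"
proof (intro conjI impI)
  show top: "topological_category (Pro_category F)"
    using assms by (rule topological_category_Pro_category)
  \<comment> \<open>Finiteness of \<open>F\<close> enters twice: the space of morphisms is a finite
    sum of compact spaces, and the object space is finite.\<close>
  assume F: "finite F"
  have "compact_space (pointwise_topology S R)" if "S \<in> F" "R \<in> F" for S R
    using assms that by (intro compact_pointwise_topology) (auto simp: profinite_semigroup_def)
  then have "compact_space (mor_top (Pro_category F))"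
    using F by (auto simp: Pro_category_def intro!: compact_space_sum_topology)
  moreover have "\<exists>E. open_congruence (Pro_category F) E \<and> (p, q) \<notin> E"
    if "p \<in> cat_mor (Pro_category F)" "q \<in> cat_mor (Pro_category F)" "p \<noteq> q" for p q
    using level_congruences_separate[OF assms(1) that] open_congruence_level_congruence[OF assms]
    by blast
  ultimately show "profinite_category (Pro_category F)"
    using top F by (intro profinite_category_if_separated[where V = F]) simp_all
qed

end
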